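(* Let $k,t$ be positive integers with $k\geq 4$. Then $$\mathrm{ex}_k(n,\mathbb{P}^{(k)}_{2t+1})\leq\mathrm{ex}_k(n,\mathbb{P}^{(k)}_{2t+2})\leq t\binom{n-1}{k-1}+O(n^{k-2}),$$ where the implied constant depends only on $k$ and $t$.
   Context: A $k$-uniform linear path of length $\ell$, $\mathbb{P}^{(k)}_\ell$, is a family of $k$-sets $\{F_1,\ldots,F_\ell\}$ with $|F_i\cap F_{i+1}|=1$ for each $i$ and $F_i\cap F_j=\emptyset$ whenever $|i-j|>1$. $\mathrm{ex}_k(n,H)$ is the maximum number of members of a family $\mathcal{F}\subseteq\binom{[n]}{k}$ containing no subfamily isomorphic to $H$. *)

theory Defs
  imports Complex_Main "HOL-Library.Ramsey"
begin

text \<open>A family of sets is a hypergraph whose vertices are the points that it covers.\<close>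

definition family_iso :: "'a set set \<Rightarrow> 'b set set \<Rightarrow> bool" where
  "family_iso H G \<longleftrightarrow> (\<exists>f. bij_betw f (\<Union>H) (\<Union>G) \<and> (\<lambda>e. f ` e) ` H = G)"

text \<open>
  For \<open>k \<ge> 2\<close> the intersection conditions force \<open>F 1, \<dots>, F l\<close> to be pairwise distinct,
  so such a family has exactly \<open>l\<close> members.
\<close>

definition linear_path :: "nat \<Rightarrow> nat \<Rightarrow> 'a set set \<Rightarrow> bool" where
  "linear_path k l P \<longleftrightarrow>
     (\<exists>F. P = F ` {1..l} \<and>
          (\<forall>i\<in>{1..l}. finite (F i) \<and> card (F i) = k) \<and>
          (\<forall>i\<in>{1..<l}. card (F i \<inter> F (i + 1)) = 1) \<and>
          (\<forall>i\<in>{1..l}. \<forall>j\<in>{1..l}. \<bar>int i - int j\<bar> > 1 \<longrightarrow> F i \<inter> F j = {}))"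

text \<open>
  The Turan number. The empty family qualifies whenever \<open>H\<close> is nonempty, and then \<open>Max\<close> is
  taken over a finite nonempty set.
\<close>

definition ex_turan :: "nat \<Rightarrow> nat \<Rightarrow> 'a set set \<Rightarrow> nat" where
  "ex_turan k n H =
     Max (card ` {\<F>. \<F> \<subseteq> nsets {1..n} k \<and> \<not> (\<exists>\<G>\<subseteq>\<F>. family_iso H \<G>)})"

lemma linear_path_exists:
  assumes "k \<ge> 2"
  shows "\<exists>P :: nat set set. linear_path k l P"
proof -
  define F where "F i = {i * (k - 1)..(i + 1) * (k - 1)}" for i :: nat
  have "F i \<inter> F (i + 1) = {(i + 1) * (k - 1)}" for i
  proof -
    have "i * (k - 1) \<le> (i + 1) * (k - 1)" "(i + 1) * (k - 1) \<le> (i + 1 + 1) * (k - 1)"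
      by simp_all
    then show ?thesis unfolding F_def by (auto simp only: Int_iff atLeastAtMost_iff set_eq_iff singleton_iff)
  qed
  then have inter: "card (F i \<inter> F (i + 1)) = 1" for i
    by simp
  have disj: "F i \<inter> F j = {}" if "i + 1 < j" for i j
  proof -
    have "(i + 1) * (k - 1) < j * (k - 1)"
      using that assms by (intro mult_strict_right_mono) auto
    then show ?thesis unfolding F_def by (simp only: Int_atLeastAtMost) simp
  qed
  have far: "F i \<inter> F j = {}" if "\<bar>int i - int j\<bar> > 1" for i j
  proof (cases "i < j")
    case True
    with that have "i + 1 < j" by linarith
    then show ?thesis by (rule disj)
  next
    case False
    with that have "j + 1 < i" by linarith
    from disj[OF this] show ?thesis by (simp only: Int_commute)
  qed
  have "finite (F i) \<and> card (F i) = k" for i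
    using assms by (simp add: F_def)
  then have "linear_path k l (F ` {1..l})"
    using inter far unfolding linear_path_def by (intro exI[of _ F]) simp
  then show ?thesis by blast
qed

end

theory Submission
  imports Defs "HOL-Library.FuncSet"
begin

text \<open>
  Call a set \<open>A\<close> flexible in a path-free family \<open>F\<close> if, whatever bounded set of points is to be
  avoided, some edge of \<open>F\<close> contains \<open>A\<close> and avoids these points outside \<open>A\<close>. By Fueredi's
  intersection semilattice method, \<open>F\<close> minus a family of size \<open>O(n ^ (k - 2))\<close> consists of edges \<open>E\<close>
  with a centre \<open>v\<close>, meaning that all pairs \<open>{v, d}\<close> with \<open>d \<in> E - {v}\<close> are flexible: otherwise
  every edge of a large homogeneous subfamily contains two flexible points, and a path is built
  greedily. An edge with centre \<open>v\<close> is determined by \<open>v\<close> and \<open>D = E - {v}\<close>. At most \<open>t\<close> centres for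
  each \<open>(k - 1)\<close>-set \<open>D\<close> give the main term. If more than a constant times \<open>n\<close> sets \<open>D\<close> had \<open>t + 1\<close> centres,
  then these would contain a path with \<open>2 * t + 2\<close> flexible pairs as edges, zigzagging between centres
  and points of the sets \<open>D\<close>, and enlarging its pairs to edges of \<open>F\<close> would give a linear path.
\<close>

section \<open>Linear paths\<close>

text \<open>Indexing from 0 and the one-sided condition \<open>Suc i < j\<close> replace the integer
  absolute value. The edges form an explicit sequence, whose initial segments are again
  paths.\<close>

definition is_path :: "nat \<Rightarrow> nat \<Rightarrow> (nat \<Rightarrow> 'a set) \<Rightarrow> bool" where
  "is_path k l F \<longleftrightarrow>
     (\<forall>i<l. finite (F i) \<and> card (F i) = k) \<and>
     (\<forall>i. Suc i < l \<longrightarrow> card (F i \<inter> F (Suc i)) = 1) \<and>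
     (\<forall>i j. Suc i < j \<longrightarrow> j < l \<longrightarrow> F i \<inter> F j = {})"

lemma linear_path_iff: "linear_path k l P \<longleftrightarrow> (\<exists>F. P = F ` {..<l} \<and> is_path k l F)"
proof
  assume "linear_path k l P"
  then obtain F where P: "P = F ` {1..l}"
    and c: "\<forall>i\<in>{1..l}. finite (F i) \<and> card (F i) = k"
    and i1: "\<forall>i\<in>{1..<l}. card (F i \<inter> F (i + 1)) = 1"
    and i2: "\<forall>i\<in>{1..l}. \<forall>j\<in>{1..l}. \<bar>int i - int j\<bar> > 1 \<longrightarrow> F i \<inter> F j = {}"
    unfolding linear_path_def by blast
  have "P = (\<lambda>i. F (Suc i)) ` {..<l}"
    unfolding P image_image[symmetric, of F Suc] image_Suc_lessThan ..
  moreover have "is_path k l (\<lambda>i. F (Suc i))"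
    unfolding is_path_def
  proof (intro conjI allI impI)
    fix i assume "i < l"
    then have "Suc i \<in> {1..l}" by simp
    then show "finite (F (Suc i))" "card (F (Suc i)) = k" using c by blast+
  next
    fix i assume "Suc i < l"
    then have "Suc i \<in> {1..<l}" by simp
    then show "card (F (Suc i) \<inter> F (Suc (Suc i))) = 1" using i1 by fastforce
  next
    fix i j assume "Suc i < j" "j < l"
    then have "Suc i \<in> {1..l}" "Suc j \<in> {1..l}" "\<bar>int (Suc i) - int (Suc j)\<bar> > 1" by simp_all
    then show "F (Suc i) \<inter> F (Suc j) = {}" using i2 by blast
  qed
  ultimately show "\<exists>F. P = F ` {..<l} \<and> is_path k l F" by blast
next
  assume "\<exists>F. P = F ` {..<l} \<and> is_path k l F"
  then obtain F where P: "P = F ` {..<l}"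
    and c: "\<And>i. i < l \<Longrightarrow> finite (F i) \<and> card (F i) = k"
    and i1: "\<And>i. Suc i < l \<Longrightarrow> card (F i \<inter> F (Suc i)) = 1"
    and i2: "\<And>i j. Suc i < j \<Longrightarrow> j < l \<Longrightarrow> F i \<inter> F j = {}"
    unfolding is_path_def by blast
  define G where "G i = F (i - 1)" for i
  have "P = G ` {1..l}"
    unfolding P G_def image_Suc_lessThan[symmetric] image_image by simp
  moreover have "\<forall>i\<in>{1..l}. finite (G i) \<and> card (G i) = k"
    using c by (auto simp: G_def)
  moreover have "\<forall>i\<in>{1..<l}. card (G i \<inter> G (i + 1)) = 1"
  proof
    fix i assume "i \<in> {1..<l}"
    then show "card (G i \<inter> G (i + 1)) = 1" using i1[of "i - 1"] by (simp add: G_def)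
  qed
  moreover have "\<forall>i\<in>{1..l}. \<forall>j\<in>{1..l}. \<bar>int i - int j\<bar> > 1 \<longrightarrow> G i \<inter> G j = {}"
  proof (intro ballI impI)
    fix i j assume ij: "i \<in> {1..l}" "j \<in> {1..l}" "\<bar>int i - int j\<bar> > 1"
    then have lt: "i - 1 < l" "j - 1 < l" by auto
    from ij have "Suc (i - 1) < j - 1 \<or> Suc (j - 1) < i - 1" by auto
    then show "G i \<inter> G j = {}"
      using i2[OF _ lt(1), of "j - 1"] i2[OF _ lt(2), of "i - 1"] unfolding G_def by blast
  qed
  ultimately show "linear_path k l P" unfolding linear_path_def by blast
qed

lemma is_path_mono: "is_path k l F \<Longrightarrow> m \<le> l \<Longrightarrow> is_path k m F"
  unfolding is_path_def by auto

text \<open>Incidence types: the points of \<open>\<Union>i<l. F i\<close> are grouped by the set of edges containing them,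
  and two families whose groups have equal sizes are isomorphic.\<close>

definition atom :: "nat \<Rightarrow> (nat \<Rightarrow> 'a set) \<Rightarrow> nat set \<Rightarrow> 'a set" where
  "atom l F I = {x. {i. i < l \<and> x \<in> F i} = I}"

text \<open>Bijections between corresponding groups glue to one map \<open>f\<close> that preserves
  the set of edges through a point, and hence sends each \<open>F i\<close> onto \<open>G i\<close>.
  The group of \<open>I = {}\<close> is left out: it consists of the points outside all edges and
  may be infinite.\<close>

lemma family_iso_if_card_atom_eq:
  assumes fin: "\<And>i. i < l \<Longrightarrow> finite (F i)" "\<And>i. i < l \<Longrightarrow> finite (G i)"
    and eq: "\<And>I. I \<noteq> {} \<Longrightarrow> card (atom l F I) = card (atom l G I)"
  shows "family_iso (F ` {..<l}) (G ` {..<l})"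
proof -
  have finat: "finite (atom l H I)" if "I \<noteq> {}" "\<And>i. i < l \<Longrightarrow> finite (H i)"
    for H :: "nat \<Rightarrow> 'c set" and I
  proof -
    from that obtain i where i: "i \<in> I" by auto
    have "atom l H I \<subseteq> (if i < l then H i else {})" using i by (auto simp: atom_def)
    then show ?thesis using that(2)[of i] by (auto intro: finite_subset split: if_splits)
  qed
  have "\<exists>b. bij_betw b (atom l F I) (atom l G I)" if "I \<noteq> {}" for I
    using finite_same_card_bij[OF finat finat eq] that fin by blast
  then obtain b where b: "\<And>I. I \<noteq> {} \<Longrightarrow> bij_betw (b I) (atom l F I) (atom l G I)"
    by metis
  define tF where "tF x = {i. i < l \<and> x \<in> F i}" for x
  define tG where "tG x = {i. i < l \<and> x \<in> G i}" for x
  define f where "f x = b (tF x) x" for x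
  have tf: "tG (f x) = tF x" if "tF x \<noteq> {}" for x
    using bij_betwE[OF b[OF that]] by (auto simp: f_def atom_def tF_def tG_def)
  have inj: "inj_on f {x. tF x \<noteq> {}}"
  proof (rule inj_onI)
    fix x y assume x: "x \<in> {x. tF x \<noteq> {}}" and y: "y \<in> {x. tF x \<noteq> {}}" and e: "f x = f y"
    then have t: "tF x = tF y" using tf[of x] tf[of y] by simp
    have "x \<in> atom l F (tF x)" "y \<in> atom l F (tF x)" using t by (auto simp: atom_def tF_def)
    moreover have "inj_on (b (tF x)) (atom l F (tF x))" using b x bij_betw_imp_inj_on by blast
    ultimately show "x = y" using e t by (auto simp: f_def inj_on_def)
  qed
  have sur: "\<exists>x. tF x = tG y \<and> f x = y" if "tG y \<noteq> {}" for y
  proof -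
    have "y \<in> atom l G (tG y)" by (auto simp: atom_def tG_def)
    moreover have "b (tG y) ` atom l F (tG y) = atom l G (tG y)"
      using bij_betw_imp_surj_on[OF b[OF that]] .
    ultimately obtain x where "x \<in> atom l F (tG y)" "b (tG y) x = y" by (metis imageE)
    then show ?thesis by (auto simp: f_def atom_def tF_def)
  qed
  have img: "f ` F i = G i" if i: "i < l" for i
  proof
    show "f ` F i \<subseteq> G i"
    proof
      fix y assume "y \<in> f ` F i"
      then obtain x where x: "x \<in> F i" "y = f x" by blast
      then have "i \<in> tF x" using i by (simp add: tF_def)
      then have "i \<in> tG y" using tf[of x] x by auto
      then show "y \<in> G i" by (simp add: tG_def)
    qed
    show "G i \<subseteq> f ` F i"
    proof
      fix y assume "y \<in> G i"
      then have "i \<in> tG y" using i by (simp add: tG_def)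
      then obtain x where x: "tF x = tG y" "f x = y" using sur by blast
      then have "x \<in> F i" using \<open>i \<in> tG y\<close> by (auto simp: tF_def)
      then show "y \<in> f ` F i" using x by blast
    qed
  qed
  have "\<Union>(F ` {..<l}) = {x. tF x \<noteq> {}}" by (auto simp: tF_def)
  then have "inj_on f (\<Union>(F ` {..<l}))" using inj by simp
  moreover have "f ` \<Union>(F ` {..<l}) = \<Union>(G ` {..<l})" using img by (auto simp: image_UN)
  moreover have "(\<lambda>e. f ` e) ` F ` {..<l} = G ` {..<l}"
    unfolding image_image using img by (intro image_cong) auto
  ultimately show ?thesis unfolding family_iso_def bij_betw_def by blast
qed

text \<open>A point lies in at most two edges, and then in consecutive ones, and an edge gives up
  one private point to each neighbour that it has. The resulting value depends only on
  \<open>k\<close>, \<open>l\<close> and \<open>I\<close>, which makes any two linear paths with the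
  same parameters isomorphic.\<close>

lemma card_atom_path:
  assumes p: "is_path k l F" and I: "I \<noteq> {}"
  shows "card (atom l F I) =
    (if \<exists>i. Suc i < l \<and> I = {i, Suc i} then 1
     else if \<exists>i<l. I = {i} then
       k - (if the_elem I = 0 then 0 else 1) - (if Suc (the_elem I) < l then 1 else 0)
     else 0)"
proof -
  have c: "\<And>i. i < l \<Longrightarrow> finite (F i) \<and> card (F i) = k"
    and i1: "\<And>i. Suc i < l \<Longrightarrow> card (F i \<inter> F (Suc i)) = 1"
    and i2: "\<And>i j. Suc i < j \<Longrightarrow> j < l \<Longrightarrow> F i \<inter> F j = {}"
    using p unfolding is_path_def by blast+
  have near: "j \<le> Suc i" if "x \<in> F i" "x \<in> F j" "j < l" for x i j
    using i2[of i j] that by (meson disjoint_iff not_less)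
  show ?thesis
  proof (cases "\<exists>i. Suc i < l \<and> I = {i, Suc i}")
    case True
    then obtain i where i: "Suc i < l" "I = {i, Suc i}" by blast
    have "atom l F I = F i \<inter> F (Suc i)"
    proof
      show "atom l F I \<subseteq> F i \<inter> F (Suc i)" using i by (auto simp: atom_def)
      show "F i \<inter> F (Suc i) \<subseteq> atom l F I"
      proof
        fix x assume x: "x \<in> F i \<inter> F (Suc i)"
        have "j = i \<or> j = Suc i" if "j < l" "x \<in> F j" for j
        proof -
          have "j \<le> Suc i" "Suc i \<le> Suc j" using near[of x i j] near[of x j "Suc i"] x that i by auto
          then show ?thesis by auto
        qed
        then show "x \<in> atom l F I" using x i by (auto simp: atom_def)
      qed
    qed
    then show ?thesis using i1[OF i(1)] True by simp
  next
    case nopair: False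
    show ?thesis
    proof (cases "\<exists>i<l. I = {i}")
      case True
      then obtain i where i: "i < l" "I = {i}" by blast
      define A where "A = (if i = 0 then {} else F (i - 1) \<inter> F i)"
      define B where "B = (if Suc i < l then F i \<inter> F (Suc i) else {})"
      have cA: "card A = (if i = 0 then 0 else 1)" using i1[of "i - 1"] i by (auto simp: A_def)
      have cB: "card B = (if Suc i < l then 1 else 0)" using i1[of i] i by (auto simp: B_def)
      have fin: "finite A" "finite B" using c[OF i(1)] by (auto simp: A_def B_def)
      have sub: "A \<subseteq> F i" "B \<subseteq> F i" by (auto simp: A_def B_def)
      have disj: "A \<inter> B = {}" using i2[of "i - 1" "Suc i"] i by (auto simp: A_def B_def)
      have "atom l F I = F i - (A \<union> B)"
      proof
        show "atom l F I \<subseteq> F i - (A \<union> B)"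
        proof
          fix x assume x: "x \<in> atom l F I"
          then have *: "j < l \<and> x \<in> F j \<longleftrightarrow> j = i" for j using i by (auto simp: atom_def)
          have "x \<in> F i" using *[of i] by simp
          moreover have "x \<notin> A" using *[of "i - 1"] i by (cases i) (auto simp: A_def)
          moreover have "x \<notin> B" using *[of "Suc i"] by (auto simp: B_def)
          ultimately show "x \<in> F i - (A \<union> B)" by simp
        qed
        show "F i - (A \<union> B) \<subseteq> atom l F I"
        proof
          fix x assume x: "x \<in> F i - (A \<union> B)"
          have "j = i" if j: "j < l" "x \<in> F j" for j
          proof (rule ccontr)
            assume ne: "j \<noteq> i"
            have "j \<le> Suc i" "i \<le> Suc j" using near[of x i j] near[of x j i] x j i by auto
            then consider "j = Suc i" | "i = Suc j" using ne by linarith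
            then show False using x j i by cases (auto simp: A_def B_def)
          qed
          then have "{j. j < l \<and> x \<in> F j} = {i}" using x i(1) by blast
          then show "x \<in> atom l F I" using i(2) by (simp add: atom_def)
        qed
      qed
      then have "card (atom l F I) = k - (card A + card B)"
        using card_Diff_subset[of "A \<union> B" "F i"] card_Un_disjoint[OF fin disj] sub fin c[OF i(1)]
        by simp
      moreover have "the_elem I = i" using i by simp
      ultimately show ?thesis unfolding if_not_P[OF nopair] if_P[OF True] using cA cB by simp
    next
      case False
      have "atom l F I = {}"
      proof (rule ccontr)
        assume "atom l F I \<noteq> {}"
        then obtain x where x: "{i. i < l \<and> x \<in> F i} = I" by (auto simp: atom_def)
        \<comment> \<open>\<open>i\<close> is the first edge through \<open>x\<close>. All edges
          through \<open>x\<close> have index at most \<open>Suc i\<close>, so \<open>I\<close> has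
          one of the two shapes already excluded.\<close>
        define i where "i = Min I"
        have fI: "finite I" using x by (auto intro: finite_subset[of _ "{..<l}"])
        have iI: "i \<in> I" unfolding i_def using fI I by simp
        have le: "i \<le> j" if "j \<in> I" for j unfolding i_def using fI that by simp
        have il: "i < l" "x \<in> F i" using iI x by auto
        have "I \<subseteq> {i, Suc i}"
        proof
          fix j assume j: "j \<in> I"
          then have "j < l" "x \<in> F j" using x by auto
          then have "j \<le> Suc i" using near il by blast
          then show "j \<in> {i, Suc i}" using le[OF j] by auto
        qed
        then have "I = {i} \<or> I = {i, Suc i}" using iI by blast
        then show False
        proof
          assume "I = {i}" then show False using False il by blast
        next
          assume e: "I = {i, Suc i}"
          then have "Suc i \<in> {i. i < l \<and> x \<in> F i}" using x by simp
          then show False using nopair e by blast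
        qed
      qed
      then show ?thesis unfolding if_not_P[OF nopair] if_not_P[OF False] by simp
    qed
  qed
qed

section \<open>Uniqueness of linear paths up to isomorphism, and the Turan number\<close>

lemma family_iso_linear_paths:
  assumes "linear_path k l P" "linear_path k l Q"
  shows "family_iso P Q"
proof -
  obtain F G where F: "P = F ` {..<l}" "is_path k l F" and G: "Q = G ` {..<l}" "is_path k l G"
    using assms unfolding linear_path_iff by blast
  show ?thesis unfolding F G
    using F(2) G(2) card_atom_path[OF F(2)] card_atom_path[OF G(2)]
    by (intro family_iso_if_card_atom_eq) (auto simp: is_path_def)
qed

lemma linear_path_family_iso:
  assumes "linear_path k l P" "family_iso P Q"
  shows "linear_path k l Q"
proof -
  obtain F where F: "P = F ` {..<l}" "is_path k l F"
    using assms unfolding linear_path_iff by blast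
  obtain f where f: "bij_betw f (\<Union>P) (\<Union>Q)" and Q: "(\<lambda>e. f ` e) ` P = Q"
    using assms unfolding family_iso_def by blast
  have inj: "inj_on f (\<Union>P)" using f bij_betw_def by blast
  have sub: "F i \<subseteq> \<Union>P" if "i < l" for i using that F by auto
  have card_eq: "card (f ` A) = card A" if "A \<subseteq> \<Union>P" for A
    by (rule card_image) (rule inj_on_subset[OF inj that])
  have Int_eq: "f ` F i \<inter> f ` F j = f ` (F i \<inter> F j)" if "i < l" "j < l" for i j
    using inj_on_image_Int[OF inj sub sub] that by simp
  have "is_path k l (\<lambda>i. f ` F i)"
    unfolding is_path_def
  proof (intro conjI allI impI)
    fix i assume "i < l"
    then show "finite (f ` F i)" "card (f ` F i) = k"
      using F(2) card_eq[OF sub] by (auto simp: is_path_def)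
  next
    fix i assume i: "Suc i < l"
    have "F i \<inter> F (Suc i) \<subseteq> \<Union>P" using sub[of i] i by auto
    then show "card (f ` F i \<inter> f ` F (Suc i)) = 1"
      using F(2) i Int_eq[of i "Suc i"] card_eq[of "F i \<inter> F (Suc i)"] by (simp add: is_path_def)
  next
    fix i j assume "Suc i < j" "j < l"
    then show "f ` F i \<inter> f ` F j = {}" using Int_eq[of i j] F(2) by (simp add: is_path_def)
  qed
  moreover have "Q = (\<lambda>i. f ` F i) ` {..<l}" using Q F by (simp add: image_image)
  ultimately show ?thesis unfolding linear_path_iff by blast
qed

text \<open>An initial segment of a copy of \<open>Q\<close> is a linear path of length
  \<open>l\<close>, hence a copy of \<open>P\<close>; so every \<open>P\<close>-free family is
  \<open>Q\<close>-free. By \<open>l \<ge> 1\<close> the empty family is \<open>P\<close>-free, so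
  \<open>Max\<close> is taken over nonempty sets.\<close>

lemma ex_turan_linear_path_mono:
  fixes P Q :: "'a set set"
  assumes "l \<ge> 1" and le: "l \<le> m" and "linear_path k l P" "linear_path k m Q"
  shows "ex_turan k n P \<le> ex_turan k n Q"
proof -
  define C where "C H = {\<F>. \<F> \<subseteq> nsets {1..n} k \<and> \<not> (\<exists>\<G>\<subseteq>\<F>. family_iso H \<G>)}" for H :: "'a set set"
  have fin: "finite (C H)" for H
    by (rule finite_subset[of _ "Pow (nsets {1..n} k)"]) (auto simp: C_def finite_imp_finite_nsets)
  have "P \<noteq> {}" using assms by (auto simp: linear_path_def)
  then have "{} \<in> C P" by (auto simp: C_def family_iso_def)
  have "C P \<subseteq> C Q"
  proof
    fix \<F> assume F: "\<F> \<in> C P"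
    have False if G: "\<G> \<subseteq> \<F>" "family_iso Q \<G>" for \<G>
    proof -
      have "linear_path k m \<G>" using assms G linear_path_family_iso by blast
      then obtain f where f: "\<G> = f ` {..<m}" "is_path k m f" unfolding linear_path_iff by blast
      have "linear_path k l (f ` {..<l})"
        unfolding linear_path_iff using is_path_mono[OF f(2) le] by blast
      then have "family_iso P (f ` {..<l})" using assms family_iso_linear_paths by blast
      moreover have "f ` {..<l} \<subseteq> \<F>" using f G le by auto
      ultimately show False using F by (auto simp: C_def)
    qed
    then show "\<F> \<in> C Q" using F by (auto simp: C_def)
  qed
  then have "card ` C P \<subseteq> card ` C Q" by blast
  then have "Max (card ` C P) \<le> Max (card ` C Q)"
    using fin \<open>{} \<in> C P\<close> by (intro Max_mono) auto
  then show ?thesis unfolding ex_turan_def C_def by simp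
qed

text \<open>The image of a sequence satisfying \<open>is_path\<close> is a copy of \<open>P\<close>.
  It therefore suffices to bound families without such a sequence, and isomorphisms do not occur any
  more.\<close>

lemma ex_turan_linear_path_le:
  assumes "l \<ge> 1" "linear_path k l P"
    and bound: "\<And>\<F>. \<F> \<subseteq> nsets {1..n} k \<Longrightarrow> \<not> (\<exists>f. is_path k l f \<and> f ` {..<l} \<subseteq> \<F>) \<Longrightarrow> card \<F> \<le> b"
  shows "ex_turan k n P \<le> b"
proof -
  define C where "C = {\<F>. \<F> \<subseteq> nsets {1..n} k \<and> \<not> (\<exists>\<G>\<subseteq>\<F>. family_iso P \<G>)}"
  have fin: "finite C"
    by (rule finite_subset[of _ "Pow (nsets {1..n} k)"]) (auto simp: C_def finite_imp_finite_nsets)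
  have "P \<noteq> {}" using assms by (auto simp: linear_path_def)
  then have "{} \<in> C" by (auto simp: C_def family_iso_def)
  have "card \<F> \<le> b" if F: "\<F> \<in> C" for \<F>
  proof (rule bound)
    show "\<F> \<subseteq> nsets {1..n} k" using F by (simp add: C_def)
    show "\<not> (\<exists>f. is_path k l f \<and> f ` {..<l} \<subseteq> \<F>)"
    proof
      assume "\<exists>f. is_path k l f \<and> f ` {..<l} \<subseteq> \<F>"
      then obtain f where f: "is_path k l f" "f ` {..<l} \<subseteq> \<F>" by blast
      then have "linear_path k l (f ` {..<l})" unfolding linear_path_iff by blast
      then have "family_iso P (f ` {..<l})" using family_iso_linear_paths assms(2) by blast
      then show False using F f by (auto simp: C_def)
    qed
  qed
  then have "Max (card ` C) \<le> b"
    using fin \<open>{} \<in> C\<close> by (intro Max.boundedI) auto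
  then show ?thesis unfolding ex_turan_def C_def by simp
qed

section \<open>Flexible sets\<close>

text \<open>The role of kernels of large sunflowers is played by the sets that can be extended to an edge
  while avoiding any prescribed small set of points.\<close>

definition flexible :: "nat \<Rightarrow> 'a set set \<Rightarrow> 'a set \<Rightarrow> bool" where
  "flexible s F A \<longleftrightarrow> (\<forall>T. finite T \<and> card T \<le> s \<longrightarrow> (\<exists>E\<in>F. A \<subseteq> E \<and> E \<inter> T \<subseteq> A))"

lemma flexibleE:
  assumes "flexible s F A" "finite T" "card T \<le> s"
  obtains E where "E \<in> F" "A \<subseteq> E" "E \<inter> T \<subseteq> A"
proof -
  have "\<exists>E\<in>F. A \<subseteq> E \<and> E \<inter> T \<subseteq> A"
    using assms(1) unfolding flexible_def using assms(2,3) by simp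
  then show thesis using that by (elim bexE conjE)
qed

lemma flexible_mono: "flexible s F A \<Longrightarrow> F \<subseteq> G \<Longrightarrow> flexible s G A"
  unfolding flexible_def by (elim all_forward imp_forward) auto

text \<open>The points \<open>p 0, ..., p l\<close> form a skeleton, whose consecutive pairs are
  enlarged to edges one after another. Each new edge avoids the rest of the skeleton and all earlier
  edges, at most \<open>Suc l + l * k\<close> points; this is the source of the bound on
  \<open>s\<close>.\<close>

lemma path_of_flexible_pairs:
  assumes uni: "\<And>E. E \<in> F \<Longrightarrow> finite E \<and> card E = k"
    and inj: "inj_on p {..l}"
    and flex: "\<And>i. i < l \<Longrightarrow> flexible s F {p i, p (Suc i)}"
    and s: "l * k + Suc l \<le> s"
  shows "\<exists>f. is_path k l f \<and> f ` {..<l} \<subseteq> F"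
proof -
  have "\<exists>f. (\<forall>i<m. f i \<in> F \<and> {p i, p (Suc i)} \<subseteq> f i \<and> f i \<inter> p ` {..l} \<subseteq> {p i, p (Suc i)}) \<and>
            (\<forall>j<m. \<forall>i<j. f i \<inter> f j \<subseteq> {p j, p (Suc j)})" if "m \<le> l" for m
    using that
  proof (induction m)
    case 0
    then show ?case by simp
  next
    case (Suc m)
    then have "m \<le> l" by simp
    from Suc.IH[OF this] obtain f where f1: "\<forall>i<m. f i \<in> F \<and> {p i, p (Suc i)} \<subseteq> f i \<and> f i \<inter> p ` {..l} \<subseteq> {p i, p (Suc i)}"
      and f2: "\<forall>j<m. \<forall>i<j. f i \<inter> f j \<subseteq> {p j, p (Suc j)}"
      by (elim exE conjE)
    note f1 = f1[rule_format] and f2 = f2[rule_format]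
    define T where "T = p ` {..l} \<union> (\<Union>i<m. f i)"
    have "finite T" using f1 uni by (auto simp: T_def)
    have "card (\<Union>i<m. f i) \<le> (\<Sum>i<m. card (f i))" by (rule card_UN_le) simp
    also have "\<dots> = m * k" using f1 uni by simp
    also have "\<dots> \<le> l * k" using Suc by simp
    finally have "card T \<le> card (p ` {..l}) + l * k"
      unfolding T_def using card_Un_le[of "p ` {..l}" "\<Union>i<m. f i"] by linarith
    also have "card (p ` {..l}) \<le> Suc l" using card_image_le[of "{..l}" p] by simp
    finally have "card T \<le> s" using s by simp
    obtain E where E: "E \<in> F" "{p m, p (Suc m)} \<subseteq> E" "E \<inter> T \<subseteq> {p m, p (Suc m)}"
      using flexibleE[OF flex \<open>finite T\<close> \<open>card T \<le> s\<close>, of m] Suc by auto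
    show ?case
    proof (intro exI[of _ "f(m := E)"] conjI allI impI)
      fix i assume "i < Suc m"
      then show "(f(m := E)) i \<in> F" "{p i, p (Suc i)} \<subseteq> (f(m := E)) i"
        "(f(m := E)) i \<inter> p ` {..l} \<subseteq> {p i, p (Suc i)}"
        using f1[of i] E unfolding T_def by (auto simp: less_Suc_eq)
    next
      fix i j assume ij: "j < Suc m" "i < j"
      show "(f(m := E)) i \<inter> (f(m := E)) j \<subseteq> {p j, p (Suc j)}"
      proof (cases "j = m")
        case True
        have "f i \<subseteq> T" using ij True unfolding T_def by auto
        then show ?thesis using True ij E by auto
      next
        case False
        then show ?thesis using f2[of j i] ij by simp
      qed
    qed
  qed
  from this[of l] obtain f where
    f1: "\<forall>i<l. f i \<in> F \<and> {p i, p (Suc i)} \<subseteq> f i \<and> f i \<inter> p ` {..l} \<subseteq> {p i, p (Suc i)}"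
    and f2: "\<forall>j<l. \<forall>i<j. f i \<inter> f j \<subseteq> {p j, p (Suc j)}"
    by auto
  note f1 = f1[rule_format] and f2 = f2[rule_format]
  \<comment> \<open>The construction confines \<open>f i \<inter> f j\<close> to the pair of the
    later edge only. That pair consists of skeleton points, and the earlier edge contains no
    skeleton points except its own pair.\<close>
  have f3: "f i \<inter> f j \<subseteq> {p i, p (Suc i)} \<inter> {p j, p (Suc j)}" if "i < j" "j < l" for i j
  proof -
    have "{p j, p (Suc j)} \<subseteq> p ` {..l}" using that by auto
    then show ?thesis using f1[of i] f2[of j i] that by fastforce
  qed
  have neq: "p i \<noteq> p j" if "i \<le> l" "j \<le> l" "i \<noteq> j" for i j
    using inj that by (auto simp: inj_on_def)
  have "is_path k l f" unfolding is_path_def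
  proof (intro conjI allI impI)
    fix i assume "i < l"
    then show "finite (f i)" "card (f i) = k" using f1 uni by auto
  next
    fix i assume i: "Suc i < l"
    have "f i \<inter> f (Suc i) \<subseteq> {p (Suc i)}"
      using f3[of i "Suc i"] neq[of i "Suc i"] neq[of i "Suc (Suc i)"] i by auto
    moreover have "p (Suc i) \<in> f i \<inter> f (Suc i)" using f1[of i] f1[of "Suc i"] i by auto
    ultimately have "f i \<inter> f (Suc i) = {p (Suc i)}" by blast
    then show "card (f i \<inter> f (Suc i)) = 1" by simp
  next
    fix i j assume ij: "Suc i < j" "j < l"
    then have "{p i, p (Suc i)} \<inter> {p j, p (Suc j)} = {}"
      using neq[of i j] neq[of "Suc i" j] neq[of i "Suc j"] neq[of "Suc i" "Suc j"] by auto
    then show "f i \<inter> f j = {}" using f3[of i j] ij by auto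
  qed
  then show ?thesis using f1 by blast
qed

text \<open>Greedy walk: leave the last edge through a flexible point \<open>q m\<close>, into a new
  edge that avoids all earlier edges elsewhere. Of the two flexible points in the new edge, one
  differs from \<open>q m\<close>; it lies outside all earlier edges and serves as the next
  exit.\<close>

lemma path_of_flexible_points:
  assumes uni: "\<And>E. E \<in> F \<Longrightarrow> finite E \<and> card E = k"
    and ne: "F \<noteq> {}"
    and flex: "\<And>E. E \<in> F \<Longrightarrow> \<exists>u\<in>E. \<exists>w\<in>E. u \<noteq> w \<and> flexible s F {u} \<and> flexible s F {w}"
    and s: "l * k \<le> s"
  shows "\<exists>f. is_path k l f \<and> f ` {..<l} \<subseteq> F"
proof (cases l)
  case 0
  then show ?thesis by (auto simp: is_path_def)
next
  case l: (Suc l')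
  \<comment> \<open>For \<open>i < m\<close> the point \<open>q i\<close> joins \<open>f i\<close>
    to \<open>f (Suc i)\<close>, while \<open>q m\<close> is the exit from the last edge, from which
    the walk continues.\<close>
  have "\<exists>f q. (\<forall>i\<le>m. f i \<in> F \<and> q i \<in> f i \<and> flexible s F {q i}) \<and> (\<forall>j<m. q m \<notin> f j) \<and>
          (\<forall>i<m. q i \<in> f (Suc i) \<and> (\<forall>j<i. q i \<notin> f j) \<and> (\<forall>j\<le>i. f j \<inter> f (Suc i) \<subseteq> {q i}))"
    if "m \<le> l'" for m
    using that
  proof (induction m)
    case 0
    obtain E where "E \<in> F" using ne by auto
    then obtain u where "u \<in> E" "flexible s F {u}" using flex by blast
    then show ?case using \<open>E \<in> F\<close> by (intro exI[of _ "\<lambda>_. E"] exI[of _ "\<lambda>_. u"]) auto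
  next
    case (Suc m)
    then have "m \<le> l'" by simp
    from Suc.IH[OF this] obtain f q where f1: "\<forall>i\<le>m. f i \<in> F \<and> q i \<in> f i \<and> flexible s F {q i}"
      and f2: "\<forall>j<m. q m \<notin> f j"
      and f3: "\<forall>i<m. q i \<in> f (Suc i) \<and> (\<forall>j<i. q i \<notin> f j) \<and> (\<forall>j\<le>i. f j \<inter> f (Suc i) \<subseteq> {q i})"
      by (elim exE conjE)
    note f1 = f1[rule_format] and f2 = f2[rule_format] and f3 = f3[rule_format]
    define T where "T = (\<Union>i\<le>m. f i)"
    have "finite T" using f1 uni by (auto simp: T_def)
    have "card T \<le> (\<Sum>i\<le>m. card (f i))" unfolding T_def by (rule card_UN_le) simp
    also have "\<dots> = Suc m * k" using f1 uni by simp
    also have "\<dots> \<le> l * k" using Suc l by (intro mult_right_mono) auto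
    also have "\<dots> \<le> s" by (rule s)
    finally obtain E where E: "E \<in> F" "{q m} \<subseteq> E" "E \<inter> T \<subseteq> {q m}"
      using flexibleE[OF _ \<open>finite T\<close>] f1 by blast
    obtain w where w: "w \<in> E" "flexible s F {w}" "w \<noteq> q m" using flex[OF E(1)] by blast
    have sub: "f j \<subseteq> T" if "j \<le> m" for j using that by (auto simp: T_def)
    have wT: "w \<notin> T" using w E by blast
    show ?case
    proof (intro exI[of _ "f(Suc m := E)"] exI[of _ "q(Suc m := w)"] conjI allI impI)
      fix i assume "i \<le> Suc m"
      then show "(f(Suc m := E)) i \<in> F" "(q(Suc m := w)) i \<in> (f(Suc m := E)) i"
        "flexible s F {(q(Suc m := w)) i}"
        using f1[of i] E w by (auto simp: le_Suc_eq)
    next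
      fix j assume "j < Suc m"
      then show "(q(Suc m := w)) (Suc m) \<notin> (f(Suc m := E)) j" using sub[of j] wT by auto
    next
      fix i assume i: "i < Suc m"
      show "(q(Suc m := w)) i \<in> (f(Suc m := E)) (Suc i)"
        using f3[of i] i E by (auto simp: less_Suc_eq)
      show "(q(Suc m := w)) i \<notin> (f(Suc m := E)) j" if "j < i" for j
        using f3[of i] f2[of j] i that by (auto simp: less_Suc_eq)
      show "(f(Suc m := E)) j \<inter> (f(Suc m := E)) (Suc i) \<subseteq> {(q(Suc m := w)) i}" if "j \<le> i" for j
      proof (cases "i = m")
        case True
        then show ?thesis using sub[of j] that E by auto
      next
        case False
        then show ?thesis using f3[of i] i that by auto
      qed
    qed
  qed
  from this[of l'] obtain f q where f1: "\<forall>i\<le>l'. f i \<in> F \<and> q i \<in> f i \<and> flexible s F {q i}"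
    and f3: "\<forall>i<l'. q i \<in> f (Suc i) \<and> (\<forall>j<i. q i \<notin> f j) \<and> (\<forall>j\<le>i. f j \<inter> f (Suc i) \<subseteq> {q i})"
    by auto
  note f1 = f1[rule_format] and f3 = f3[rule_format]
  have "is_path k l f" unfolding is_path_def
  proof (intro conjI allI impI)
    fix i assume "i < l"
    then show "finite (f i)" "card (f i) = k" using f1 uni l by auto
  next
    fix i assume i: "Suc i < l"
    then have "f i \<inter> f (Suc i) = {q i}" using f1[of i] f3[of i] l by auto
    then show "card (f i \<inter> f (Suc i)) = 1" by simp
  next
    fix i j assume ij: "Suc i < j" "j < l"
    then obtain j' where j: "j = Suc j'" by (cases j) auto
    then have "f i \<inter> f j \<subseteq> {q j'}" "q j' \<notin> f i" using f3[of j'] ij l by auto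
    then show "f i \<inter> f j = {}" by auto
  qed
  then show ?thesis using f1 l by auto
qed

section \<open>Colourings and homogeneous subfamilies\<close>

text \<open>Averaging over all colourings of \<open>V\<close>.\<close>

lemma exists_agreeing_coloring:
  fixes S :: "'i \<Rightarrow> 'a set" and g :: "'i \<Rightarrow> 'a \<Rightarrow> nat"
  assumes V: "finite V" and I: "finite I" and q: "q > 0"
    and S: "\<And>i. i \<in> I \<Longrightarrow> S i \<subseteq> V" "\<And>i. i \<in> I \<Longrightarrow> card (S i) \<le> m"
    and g: "\<And>i x. i \<in> I \<Longrightarrow> x \<in> S i \<Longrightarrow> g i x < q"
  shows "\<exists>c. card I \<le> q ^ m * card {i \<in> I. \<forall>x\<in>S i. c x = g i x}"
proof (rule ccontr)
  define C where "C = V \<rightarrow>\<^sub>E {..<q}"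
  have finC: "finite C" unfolding C_def using V by (intro finite_PiE) auto
  have cC: "card C = q ^ card V" unfolding C_def using V by (simp add: card_PiE)
  assume "\<not> ?thesis"
  then have less: "q ^ m * card {i \<in> I. \<forall>x\<in>S i. c x = g i x} < card I" for c
    by (simp add: not_le)
  have count: "card {x \<in> X. P x} = (\<Sum>x\<in>X. if P x then 1 else 0)" if "finite X"
    for X :: "'x set" and P
    unfolding sum.inter_filter[OF that, symmetric] by simp
  \<comment> \<open>At most \<open>m\<close> colours are prescribed on \<open>S i\<close>, so a
    fraction of at least \<open>1 / q ^ m\<close> of all colourings agrees with \<open>g i\<close>.
    Counting pairs of an index and an agreeing colouring in two ways then contradicts
    \<open>less\<close>.\<close>
  have A: "q ^ card V \<le> q ^ m * card {c \<in> C. \<forall>x\<in>S i. c x = g i x}" if i: "i \<in> I" for i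
  proof -
    have "{c \<in> C. \<forall>x\<in>S i. c x = g i x} = PiE V (\<lambda>x. if x \<in> S i then {g i x} else {..<q})"
      unfolding C_def using S[OF i] g[OF i] by (fastforce simp: PiE_iff split: if_splits)
    then have "card {c \<in> C. \<forall>x\<in>S i. c x = g i x} = (\<Prod>x\<in>V. if x \<in> S i then 1 else q)"
      using V by (simp add: card_PiE if_distrib cong: if_cong)
    also have "\<dots> = q ^ card (V - S i)"
      using V by (simp add: prod.If_cases Diff_eq)
    also have "card (V - S i) = card V - card (S i)"
      using S[OF i] V by (intro card_Diff_subset) (auto intro: finite_subset)
    finally have "q ^ m * card {c \<in> C. \<forall>x\<in>S i. c x = g i x} = q ^ (m + (card V - card (S i)))"
      by (simp add: power_add)
    then show ?thesis using S(2)[OF i] q by (simp add: power_increasing)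
  qed
  have "card I * q ^ card V \<le> (\<Sum>i\<in>I. q ^ m * card {c \<in> C. \<forall>x\<in>S i. c x = g i x})"
    using A sum_mono[of I "\<lambda>_. q ^ card V"] by simp
  also have "\<dots> = q ^ m * (\<Sum>i\<in>I. \<Sum>c\<in>C. if \<forall>x\<in>S i. c x = g i x then 1 else 0)"
    unfolding sum_distrib_left[symmetric] count[OF finC] ..
  also have "\<dots> = q ^ m * (\<Sum>c\<in>C. \<Sum>i\<in>I. if \<forall>x\<in>S i. c x = g i x then 1 else 0)"
    by (subst sum.swap) simp
  also have "\<dots> = (\<Sum>c\<in>C. q ^ m * card {i \<in> I. \<forall>x\<in>S i. c x = g i x})"
    unfolding sum_distrib_left[symmetric] count[OF I] ..
  also have "\<dots> < (\<Sum>c\<in>C. card I)"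
  proof (rule sum_strict_mono)
    show "C \<noteq> {}" using cC q by auto
  qed (use finC less in auto)
  also have "\<dots> = card I * q ^ card V" using cC by simp
  finally show False by simp
qed

section \<open>Types of subsets of coloured edges\<close>

definition part :: "('a \<Rightarrow> nat) \<Rightarrow> 'a set \<Rightarrow> nat set \<Rightarrow> 'a set" where
  "part c E A = {x \<in> E. c x \<in> A}"

definition absent :: "('a \<Rightarrow> nat) \<Rightarrow> 'a set set \<Rightarrow> nat set \<Rightarrow> bool" where
  "absent c H A \<longleftrightarrow> (\<forall>E\<in>H. \<forall>E'\<in>H. E \<noteq> E' \<longrightarrow> E \<inter> E' \<noteq> part c E A)"

lemma absent_subset: "absent c H A \<Longrightarrow> H' \<subseteq> H \<Longrightarrow> absent c H' A"
  unfolding absent_def by auto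

lemma card_part:
  assumes "bij_betw c E {..<k}" "A \<subseteq> {..<k}"
  shows "card (part c E A) = card A"
proof -
  have "c ` part c E A = c ` E \<inter> A" by (auto simp: part_def)
  then have "c ` part c E A = A" using assms(2) bij_betw_imp_surj_on[OF assms(1)] by auto
  moreover have "inj_on c (part c E A)"
    using bij_betw_imp_inj_on[OF assms(1)] by (rule inj_on_subset) (auto simp: part_def)
  ultimately show ?thesis using card_image[of c "part c E A"] by simp
qed

text \<open>Each edge has exactly \<open>card A\<close> points with colours in \<open>A\<close>, so
  an edge containing those of \<open>E\<close> has no others. Hence an intersection of type
  \<open>A\<close> has this type seen from either edge, and the asymmetry in \<open>absent\<close>
  is harmless.\<close>

lemma part_eq_if_subset:
  assumes E: "bij_betw c E {..<k}" and E': "bij_betw c E' {..<k}" and A: "A \<subseteq> {..<k}"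
    and sub: "part c E A \<subseteq> E'"
  shows "part c E' A = part c E A"
proof -
  have "finite E'" using E' bij_betw_finite by blast
  then have "finite (part c E' A)" by (simp add: part_def)
  moreover have "part c E A \<subseteq> part c E' A" using sub by (auto simp: part_def)
  moreover have "card (part c E A) = card (part c E' A)"
    using card_part[OF E A] card_part[OF E' A] by simp
  ultimately show ?thesis using card_subset_eq by metis
qed

lemma popular_point:
  assumes "finite G" "finite T" "card T \<le> s" and hit: "\<And>E. E \<in> G \<Longrightarrow> E \<inter> T \<noteq> {}" and "G \<noteq> {}"
  shows "\<exists>p\<in>T. card G \<le> s * card {E \<in> G. p \<in> E}"
proof (rule ccontr)
  assume "\<not> ?thesis"
  then have less: "s * card {E \<in> G. p \<in> E} < card G" if "p \<in> T" for p using that by force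
  have "G \<subseteq> (\<Union>p\<in>T. {E \<in> G. p \<in> E})" using hit by blast
  then have "card G \<le> card (\<Union>p\<in>T. {E \<in> G. p \<in> E})"
    using assms by (intro card_mono) auto
  also have "\<dots> \<le> (\<Sum>p\<in>T. card {E \<in> G. p \<in> E})" by (rule card_UN_le) fact
  finally have "s * card G \<le> (\<Sum>p\<in>T. s * card {E \<in> G. p \<in> E})"
    by (simp flip: sum_distrib_left)
  also have "\<dots> < (\<Sum>p\<in>T. card G)"
    using less assms hit by (intro sum_strict_mono) auto
  also have "\<dots> \<le> s * card G" using assms by simp
  finally show False by simp
qed

text \<open>If some \<open>S = part c E0 A\<close> is not flexible, all edges with
  \<open>A\<close>-part \<open>S\<close> meet a bounded set outside \<open>S\<close>, and a point
  \<open>p\<close> there lies in a fraction of at least \<open>1 / s\<close> of them. These edges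
  \<open>Gp\<close> join \<open>R A\<close>, and the whole block \<open>G\<close> is removed.
  Flexibility refers to the remaining family, so the argument is repeated for
  \<open>H - G\<close>.\<close>

lemma flexible_decomposition:
  assumes "finite \<A>" "\<A> \<subseteq> Pow {..<k}" "finite H" "\<forall>E\<in>H. bij_betw c E {..<k}"
  shows "\<exists>H0 R. H0 \<subseteq> H \<and> (\<forall>A\<in>\<A>. \<forall>E\<in>H0. flexible s H0 (part c E A)) \<and>
    (\<forall>A\<in>\<A>. R A \<subseteq> H \<and> absent c (R A) A) \<and> card H \<le> card H0 + (\<Sum>A\<in>\<A>. s * card (R A))"
  using assms(3,4)
proof (induction H rule: finite_psubset_induct)
  case (psubset H)
  show ?case
  proof (cases "\<forall>A\<in>\<A>. \<forall>E\<in>H. flexible s H (part c E A)")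
    case True
    then show ?thesis by (intro exI[of _ H] exI[of _ "\<lambda>_. {}"]) (auto simp: absent_def)
  next
    case False
    then obtain A E0 where A: "A \<in> \<A>" and E0: "E0 \<in> H" and nflex: "\<not> flexible s H (part c E0 A)"
      by blast
    define S where "S = part c E0 A"
    define G where "G = {E \<in> H. part c E A = S}"
    have G: "G \<subseteq> H" "G \<noteq> {}" "finite G" using E0 psubset.hyps by (auto simp: G_def S_def)
    obtain T where T: "finite T" "card T \<le> s" "\<And>E. E \<in> H \<Longrightarrow> S \<subseteq> E \<Longrightarrow> \<not> E \<inter> T \<subseteq> S"
      using nflex unfolding flexible_def S_def[symmetric] by auto
    have hit: "E \<inter> (T - S) \<noteq> {}" if "E \<in> G" for E
    proof -
      have "E \<in> H" "S \<subseteq> E" using that by (auto simp: G_def part_def)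
      then show ?thesis using T(3)[of E] by blast
    qed
    have "card (T - S) \<le> s" using T(1,2) card_mono[of T "T - S"] by simp
    then obtain p where p: "p \<in> T - S" "card G \<le> s * card {E \<in> G. p \<in> E}"
      using popular_point[OF G(3) _ _ hit G(2), of s] T(1) by blast
    have "H - G \<subset> H" using G by blast
    moreover have "\<forall>E\<in>H - G. bij_betw c E {..<k}" using psubset.prems by simp
    ultimately obtain H0 R where H0: "H0 \<subseteq> H - G" "\<forall>A\<in>\<A>. \<forall>E\<in>H0. flexible s H0 (part c E A)"
      and R: "\<forall>A\<in>\<A>. R A \<subseteq> H - G \<and> absent c (R A) A"
      and cd: "card (H - G) \<le> card H0 + (\<Sum>A\<in>\<A>. s * card (R A))"
      using psubset.IH[of "H - G"] by (elim meta_impE exE conjE)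
    define Gp where "Gp = {E \<in> G. p \<in> E}"
    have Gp: "Gp \<subseteq> G" by (auto simp: Gp_def)
    have RA: "R A \<subseteq> H - G" "absent c (R A) A" using R A by auto
    have AK: "A \<subseteq> {..<k}" using A assms by auto
    \<comment> \<open>Two edges of \<open>Gp\<close> share \<open>p\<close> besides
      \<open>S\<close>, so their intersection exceeds their \<open>A\<close>-part; an edge of
      \<open>Gp\<close> and one of \<open>R A\<close> have different \<open>A\<close>-parts.\<close>
    have new: "absent c (R A \<union> Gp) A" unfolding absent_def
    proof (intro ballI impI notI)
      fix E E' assume E: "E \<in> R A \<union> Gp" and E': "E' \<in> R A \<union> Gp" and ne: "E \<noteq> E'"
        and eq: "E \<inter> E' = part c E A"
      have EH: "E \<in> H" "E' \<in> H" using E E' RA Gp G by auto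
      have same: "part c E' A = part c E A"
        using part_eq_if_subset[OF _ _ AK] psubset.prems EH eq by blast
      show False
      proof (cases "E \<in> Gp")
        case True
        then have "part c E A = S" using Gp by (auto simp: G_def)
        then have "E' \<in> G" using same EH by (auto simp: G_def)
        then have "E' \<in> Gp" using E' RA by blast
        then have "p \<in> E \<inter> E'" using True by (auto simp: Gp_def)
        then show False using eq \<open>part c E A = S\<close> p by blast
      next
        case False
        then have "E \<in> R A" using E by blast
        then have "E \<notin> G" using RA by blast
        then have "part c E A \<noteq> S" using EH by (auto simp: G_def)
        then have "E' \<notin> Gp" using same Gp by (auto simp: G_def)
        then have "E' \<in> R A" using E' by blast
        then show False using RA(2) \<open>E \<in> R A\<close> ne eq unfolding absent_def by blast
      qed
    qed
    have "finite (R A)" using RA psubset.hyps by (meson Diff_subset finite_subset)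
    then have "card (R A \<union> Gp) = card (R A) + card Gp"
      using RA Gp G by (intro card_Un_disjoint) (auto intro: finite_subset)
    then have "(\<Sum>B\<in>\<A>. s * card (R B)) + s * card Gp = (\<Sum>B\<in>\<A>. s * card ((R(A := R A \<union> Gp)) B))"
      using sum.remove[OF assms(1) A, of "\<lambda>B. s * card (R B)"]
        sum.remove[OF assms(1) A, of "\<lambda>B. s * card ((R(A := R A \<union> Gp)) B)"]
      by (simp add: algebra_simps)
    moreover have "card H = card (H - G) + card G"
      using G psubset.hyps by (metis card_Diff_subset card_mono le_add_diff_inverse2)
    ultimately have "card H \<le> card H0 + (\<Sum>B\<in>\<A>. s * card ((R(A := R A \<union> Gp)) B))"
      using cd p unfolding Gp_def by linarith
    moreover have "\<forall>B\<in>\<A>. (R(A := R A \<union> Gp)) B \<subseteq> H \<and> absent c ((R(A := R A \<union> Gp)) B) B"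
      using R new Gp G by auto
    moreover have "H0 \<subseteq> H" using H0 by blast
    ultimately show ?thesis using H0(2)
      by (intro exI[of _ H0] exI[of _ "R(A := R A \<union> Gp)"]) (intro conjI)
  qed
qed

definition homogeneous ::
  "nat \<Rightarrow> nat set set \<Rightarrow> ('a \<Rightarrow> nat) \<Rightarrow> 'a set set \<Rightarrow> nat set set \<Rightarrow> bool" where
  "homogeneous s \<A> c H J \<longleftrightarrow> J \<subseteq> \<A> \<and> (\<forall>A\<in>J. \<forall>E\<in>H. flexible s H (part c E A)) \<and>
     (\<forall>A\<in>\<A> - J. absent c H A)"

text \<open>A bound for the subfamilies in which each type \<open>A \<in> \<A>\<close> is either flexible for all edges or
  never occurs as an intersection yields a bound for the whole family: in each block of the
  decomposition above one more type never occurs.\<close>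

lemma homogeneous_bound:
  assumes "finite \<A>" "\<A> \<subseteq> Pow {..<k}"
  shows "\<exists>M. \<forall>(c :: 'a \<Rightarrow> nat) H h. finite H \<longrightarrow> (\<forall>E\<in>H. bij_betw c E {..<k}) \<longrightarrow>
    (\<forall>H' J. H' \<subseteq> H \<longrightarrow> homogeneous s \<A> c H' J \<longrightarrow> card H' \<le> h) \<longrightarrow> card H \<le> M * h"
  using assms
proof (induction \<A> rule: finite_psubset_induct)
  case (psubset \<A>)
  have ih: "\<exists>M. \<forall>(c :: 'a \<Rightarrow> nat) H h. finite H \<longrightarrow> (\<forall>E\<in>H. bij_betw c E {..<k}) \<longrightarrow>
    (\<forall>H' J. H' \<subseteq> H \<longrightarrow> homogeneous s (\<A> - {A}) c H' J \<longrightarrow> card H' \<le> h) \<longrightarrow> card H \<le> M * h"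
    if "A \<in> \<A>" for A
  proof -
    have "\<A> - {A} \<subset> \<A>" "\<A> - {A} \<subseteq> Pow {..<k}" using that psubset.prems by auto
    from psubset.IH[OF this] show ?thesis .
  qed
  have "\<forall>A\<in>\<A>. \<exists>M. \<forall>(c :: 'a \<Rightarrow> nat) H h. finite H \<longrightarrow> (\<forall>E\<in>H. bij_betw c E {..<k}) \<longrightarrow>
    (\<forall>H' J. H' \<subseteq> H \<longrightarrow> homogeneous s (\<A> - {A}) c H' J \<longrightarrow> card H' \<le> h) \<longrightarrow> card H \<le> M * h"
    using ih by blast
  from bchoice[OF this] obtain M where
    M: "\<forall>A\<in>\<A>. \<forall>(c :: 'a \<Rightarrow> nat) H h. finite H \<longrightarrow> (\<forall>E\<in>H. bij_betw c E {..<k}) \<longrightarrow>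
    (\<forall>H' J. H' \<subseteq> H \<longrightarrow> homogeneous s (\<A> - {A}) c H' J \<longrightarrow> card H' \<le> h) \<longrightarrow> card H \<le> M A * h"
    by (elim exE)
  \<comment> \<open>The summand 1 pays for \<open>H0\<close>, in which all types are flexible, and
    \<open>s * M A\<close> pays for \<open>R A\<close>, in which \<open>A\<close> is absent, so that
    the bound for \<open>\<A> - {A}\<close> applies.\<close>
  have "card H \<le> (1 + (\<Sum>A\<in>\<A>. s * M A)) * h"
    if H: "finite H" "\<forall>E\<in>H. bij_betw c E {..<k}"
      and bound: "\<And>H' J. H' \<subseteq> H \<Longrightarrow> homogeneous s \<A> c H' J \<Longrightarrow> card H' \<le> h"
    for c :: "'a \<Rightarrow> nat" and H h
  proof -
    obtain H0 R where H0: "H0 \<subseteq> H" "\<forall>A\<in>\<A>. \<forall>E\<in>H0. flexible s H0 (part c E A)"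
      and R: "\<forall>A\<in>\<A>. R A \<subseteq> H \<and> absent c (R A) A"
      and cd: "card H \<le> card H0 + (\<Sum>A\<in>\<A>. s * card (R A))"
      using flexible_decomposition[OF psubset.hyps(1) psubset.prems H, of s] by (elim exE conjE)
    have "card H0 \<le> h" using bound[OF H0(1), of \<A>] H0(2) by (simp add: homogeneous_def)
    moreover have "card (R A) \<le> M A * h" if A: "A \<in> \<A>" for A
    proof -
      have RA: "R A \<subseteq> H" "absent c (R A) A" using R A by auto
      have "card H' \<le> h" if H': "H' \<subseteq> R A" "homogeneous s (\<A> - {A}) c H' J" for H' J
      proof (rule bound)
        show "H' \<subseteq> H" using H' RA by blast
        have "absent c H' A" using absent_subset[OF RA(2) H'(1)] .
        then show "homogeneous s \<A> c H' J" using H'(2) unfolding homogeneous_def by blast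
      qed
      moreover have "finite (R A)" "\<forall>E\<in>R A. bij_betw c E {..<k}"
        using RA H finite_subset by auto
      ultimately show ?thesis using M[rule_format, OF A, of "R A" c h] by blast
    qed
    ultimately have "card H \<le> h + (\<Sum>A\<in>\<A>. s * (M A * h))"
      using cd sum_mono[of \<A> "\<lambda>A. s * card (R A)" "\<lambda>A. s * (M A * h)"]
      by (meson add_mono le_trans mult_le_mono2)
    then show ?thesis by (simp add: sum_distrib_right mult.assoc)
  qed
  then show ?case
    by (intro exI[of _ "1 + (\<Sum>A\<in>\<A>. s * M A)"]) blast
qed

section \<open>Flexible types: two flexible points or a centre\<close>

text \<open>The complements of members of \<open>J\<close> form a family \<open>X\<close> closed
  under union, so \<open>{w}\<close> or \<open>{v, d}\<close> is in \<open>J\<close> once its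
  complement is a nonempty union of sets in \<open>X\<close>. For all \<open>i \<noteq> j\<close>,
  \<open>cover\<close> puts one of \<open>{i, j}\<close>, \<open>{i}\<close>, \<open>{j}\<close>
  into \<open>X\<close>, which supplies enough small sets.\<close>

lemma intersection_closed_types:
  fixes k :: nat
  assumes k: "k \<ge> 4" and J: "J \<subseteq> Pow {..<k} - {{..<k}}"
    and closed: "\<And>A B. A \<in> J \<Longrightarrow> B \<in> J \<Longrightarrow> A \<inter> B \<in> J"
    and cover: "\<And>B. B \<subseteq> {..<k} \<Longrightarrow> card B = k - 2 \<Longrightarrow> \<exists>A\<in>J. B \<subseteq> A"
  shows "(\<exists>u<k. \<exists>w<k. u \<noteq> w \<and> {u} \<in> J \<and> {w} \<in> J) \<or> (\<exists>v<k. \<forall>d<k. d \<noteq> v \<longrightarrow> {v, d} \<in> J)"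
proof -
  define K where "K = {..<k}"
  define X where "X = {Y. Y \<subseteq> K \<and> K - Y \<in> J}"
  have finX: "finite X" unfolding X_def K_def by (rule finite_subset[of _ "Pow {..<k}"]) auto
  have Un: "Y \<union> Z \<in> X" if "Y \<in> X" "Z \<in> X" for Y Z
    using closed[of "K - Y" "K - Z"] that by (auto simp: X_def Diff_Un)
  have Union: "\<Union>\<Y> \<in> X" if "finite \<Y>" "\<Y> \<noteq> {}" "\<Y> \<subseteq> X" for \<Y>
    using that by (induction \<Y> rule: finite_ne_induct) (auto intro: Un)
  have cofill: "K - U \<in> J" if U: "U \<subseteq> K" "U \<noteq> {}" and ex: "\<And>x. x \<in> U \<Longrightarrow> \<exists>Y\<in>X. x \<in> Y \<and> Y \<subseteq> U" for U
  proof -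
    define \<Y> where "\<Y> = {Y \<in> X. Y \<subseteq> U}"
    have "\<Union>\<Y> = U" using ex by (auto simp: \<Y>_def)
    moreover have "\<Y> \<noteq> {}" "finite \<Y>" "\<Y> \<subseteq> X" using ex U finX by (auto simp: \<Y>_def)
    ultimately have "U \<in> X" using Union by metis
    then show ?thesis by (simp add: X_def)
  qed
  \<comment> \<open>\<open>T\<close> collects the points whose singletons are missing from
    \<open>X\<close>; any two of them form a pair in \<open>X\<close>.\<close>
  define T where "T = {i \<in> K. {i} \<notin> X}"
  have finT: "finite T" "T \<subseteq> K" by (auto simp: T_def K_def)
  have pairs: "{i, j} \<in> X" if ij: "i \<in> T" "j \<in> T" "i \<noteq> j" for i j
  proof -
    have ijK: "i \<in> K" "j \<in> K" using ij finT by auto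
    have "card (K - {i, j}) = k - 2" using ijK ij(3) by (simp add: card_Diff_subset K_def)
    then obtain A where A: "A \<in> J" "K - {i, j} \<subseteq> A" using cover[of "K - {i, j}"] by (auto simp: K_def)
    have AK: "A \<subseteq> K" "A \<noteq> K" using A J by (auto simp: K_def)
    have "K - {i} \<notin> J" "K - {j} \<notin> J" using ij ijK by (auto simp: T_def X_def)
    moreover have "A = K - {i, j} \<or> A = K - {i} \<or> A = K - {j}" using A(2) AK ijK by blast
    ultimately have "K - {i, j} \<in> J" using A(1) by blast
    then show ?thesis using ijK by (simp add: X_def)
  qed
  show ?thesis
  proof (cases "card T \<ge> 2")
    case False
    obtain v where v: "v \<in> K" "T \<subseteq> {v}"
    proof (cases "T = {}")
      case True
      then show ?thesis using that[of 0] k by (auto simp: K_def)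
    next
      case ne: False
      then have "card T = 1" using False finT card_gt_0_iff[of T] by linarith
      then obtain v where "T = {v}" using card_1_singletonE by blast
      then show ?thesis using that finT by blast
    qed
    \<comment> \<open>All singletons other than possibly \<open>{v}\<close> belong to
      \<open>X\<close>, and \<open>K - {v, d}\<close> is a nonempty union of them because
      \<open>k > 2\<close>.\<close>
    have "{v, d} \<in> J" if d: "d < k" "d \<noteq> v" for d
    proof -
      have "K - {v, d} \<noteq> {}"
      proof
        assume "K - {v, d} = {}"
        then have "card K \<le> card {v, d}" by (intro card_mono) auto
        then show False using k d by (simp add: K_def)
      qed
      moreover have "\<exists>Y\<in>X. x \<in> Y \<and> Y \<subseteq> K - {v, d}" if "x \<in> K - {v, d}" for x
        using that v by (intro bexI[of _ "{x}"]) (auto simp: T_def)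
      ultimately have "K - (K - {v, d}) \<in> J" by (intro cofill) auto
      moreover have "K - (K - {v, d}) = {v, d}" using v d by (auto simp: K_def)
      ultimately show ?thesis by simp
    qed
    then show ?thesis using v by (auto simp: K_def)
  next
    case True
    \<comment> \<open>Points of \<open>T - {w}\<close> are covered by pairs inside
      \<open>T - {w}\<close>, for which a second point must exist there; all other points are
      covered by singletons.\<close>
    have single: "{w} \<in> J" if w: "w \<in> K" "card (T - {w}) \<ge> 2" for w
    proof -
      have "\<exists>Y\<in>X. x \<in> Y \<and> Y \<subseteq> K - {w}" if x: "x \<in> K - {w}" for x
      proof (cases "x \<in> T")
        case False
        then show ?thesis using x by (intro bexI[of _ "{x}"]) (auto simp: T_def)
      next
        case xT: True
        have "T - {w} \<noteq> {x}"
        proof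
          assume "T - {w} = {x}"
          then show False using w(2) by simp
        qed
        then obtain y where "y \<in> T - {w}" "y \<noteq> x" using xT x by blast
        then show ?thesis using pairs[of x y] xT x finT by (intro bexI[of _ "{x, y}"]) auto
      qed
      moreover have "K - {w} \<noteq> {}" 
      proof
        assume "K - {w} = {}"
        then have "T - {w} = {}" using finT by blast
        then have "card (T - {w}) = 0" by (simp only: card.empty)
        then show False using w(2) by linarith
      qed
      ultimately have "K - (K - {w}) \<in> J" by (intro cofill) auto
      then show ?thesis using w by (simp add: double_diff)
    qed
    \<comment> \<open>If \<open>card T = 2\<close>, the two points come from outside
      \<open>T\<close>, where \<open>k \<ge> 4\<close> leaves room; if \<open>T\<close> is larger,
      any two points of \<open>T\<close> will do.\<close>
    obtain u w where "u \<in> K" "w \<in> K" "u \<noteq> w" "card (T - {u}) \<ge> 2" "card (T - {w}) \<ge> 2"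
    proof (cases "card T = 2")
      case two: True
      have "card (K - T) \<ge> 2" using finT two k by (simp add: card_Diff_subset K_def)
      then obtain B where B: "B \<subseteq> K - T" "card B = 2" by (meson obtain_subset_with_card_n)
      then obtain u w where "B = {u, w}" "u \<noteq> w" by (meson card_2_iff)
      then show ?thesis using that[of u w] B two by auto
    next
      case False
      then have three: "card T \<ge> 3" using True by simp
      obtain B where B: "B \<subseteq> T" "card B = 2" using True by (meson obtain_subset_with_card_n)
      then obtain u w where "B = {u, w}" "u \<noteq> w" by (meson card_2_iff)
      moreover have "u \<in> T" "w \<in> T" using B \<open>B = {u, w}\<close> by auto
      moreover from this have "card (T - {u}) \<ge> 2" "card (T - {w}) \<ge> 2"
        using three by simp_all
      ultimately show ?thesis using that[of u w] finT(2) by blast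
    qed
    then show ?thesis using single by (auto simp: K_def)
  qed
qed

text \<open>The set \<open>J\<close> of flexible types meets the hypotheses of
  \<open>intersection_closed_types\<close>: it is closed under intersection because all other proper
  types are absent, and it covers because \<open>H\<close> is too large for its edges to be
  determined by \<open>k - 2\<close> of their points.\<close>

lemma homogeneous_dichotomy:
  fixes c :: "'a \<Rightarrow> nat"
  assumes k: "k \<ge> 4" and s: "2 * k \<le> s" and V: "finite V" and HV: "H \<subseteq> nsets V k"
    and rb: "\<forall>E\<in>H. bij_betw c E {..<k}"
    and hom: "homogeneous s (Pow {..<k} - {{..<k}}) c H J"
    and large: "card V choose (k - 2) < card H"
  shows "(\<forall>E\<in>H. \<exists>u\<in>E. \<exists>w\<in>E. u \<noteq> w \<and> flexible s H {u} \<and> flexible s H {w}) \<or>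
         (\<forall>E\<in>H. \<exists>v\<in>E. \<forall>d\<in>E - {v}. flexible s H {v, d})"
proof -
  have J: "J \<subseteq> Pow {..<k} - {{..<k}}"
    and fx: "\<And>A E. A \<in> J \<Longrightarrow> E \<in> H \<Longrightarrow> flexible s H (part c E A)"
    and ab: "\<And>A. A \<subset> {..<k} \<Longrightarrow> A \<notin> J \<Longrightarrow> absent c H A"
    using hom by (auto simp: homogeneous_def)
  have uni: "finite E" "card E = k" "E \<subseteq> V" if "E \<in> H" for E using HV that by (auto simp: nsets_def)
  obtain E where E: "E \<in> H" using large by fastforce
  \<comment> \<open>Extend \<open>part c E A\<close> to \<open>F1\<close> avoiding \<open>E\<close>
    elsewhere, then \<open>part c E B\<close> to \<open>F2\<close> avoiding \<open>E\<close> and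
    \<open>F1\<close> elsewhere; avoiding two edges costs \<open>2 * k \<le> s\<close>. Then
    \<open>F1\<close> and \<open>F2\<close> meet exactly in \<open>part c E (A \<inter> B)\<close>,
    so this type is not absent.\<close>
  have closed: "A \<inter> B \<in> J" if AB: "A \<in> J" "B \<in> J" for A B
  proof (rule ccontr)
    assume n: "A \<inter> B \<notin> J"
    have AB': "A \<subset> {..<k}" "B \<subset> {..<k}" using AB J by auto
    obtain F1 where F1: "F1 \<in> H" "part c E A \<subseteq> F1" "F1 \<inter> E \<subseteq> part c E A"
      using flexibleE[OF fx[OF AB(1) E], of E] uni[OF E] s by auto
    have "card (E \<union> F1) \<le> s" using card_Un_le[of E F1] uni[OF E] uni[OF F1(1)] s by simp
    then obtain F2 where F2: "F2 \<in> H" "part c E B \<subseteq> F2" "F2 \<inter> (E \<union> F1) \<subseteq> part c E B"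
      using flexibleE[OF fx[OF AB(2) E], of "E \<union> F1"] uni[OF E] uni[OF F1(1)] by auto
    have eq: "F1 \<inter> F2 = part c E (A \<inter> B)" using F1 F2 by (auto simp: part_def)
    have same: "part c F1 (A \<inter> B) = part c E (A \<inter> B)"
      using AB' F1 F2 E rb eq by (intro part_eq_if_subset[where k = k]) auto
    have "card (part c E (A \<inter> B)) = card (A \<inter> B)" using AB' rb E by (intro card_part) auto
    also have "\<dots> < card {..<k}" using AB' by (intro psubset_card_mono) auto
    finally have "F1 \<noteq> F2" using eq uni[OF F1(1)] by auto
    moreover have "absent c H (A \<inter> B)" using ab[of "A \<inter> B"] n AB' by blast
    then have "F1 \<noteq> F2 \<longrightarrow> F1 \<inter> F2 \<noteq> part c F1 (A \<inter> B)"
      using F1(1) F2(1) by (simp add: absent_def)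
    ultimately show False using eq same by simp
  qed
  have cover: "\<exists>A\<in>J. B \<subseteq> A" if B: "B \<subseteq> {..<k}" "card B = k - 2" for B
  proof (rule ccontr)
    assume n: "\<not> ?thesis"
    \<comment> \<open>Two edges with the same \<open>B\<close>-part would intersect in a set whose
      type contains \<open>B\<close> and, not being absent, belongs to \<open>J\<close>.\<close>
    have "inj_on (\<lambda>E. part c E B) H"
    proof (rule inj_onI, rule ccontr)
      fix E E' assume EE: "E \<in> H" "E' \<in> H" and eq: "part c E B = part c E' B" and ne: "E \<noteq> E'"
      define A where "A = c ` (E \<inter> E')"
      have cE: "c ` E = {..<k}" "inj_on c E" using rb EE by (auto simp: bij_betw_def)
      have pA: "part c E A = E \<inter> E'" using cE(2) by (auto simp: part_def A_def inj_on_def)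
      have "A \<subseteq> {..<k}" using cE by (auto simp: A_def)
      moreover have "A \<noteq> {..<k}"
      proof
        assume "A = {..<k}"
        then have "E \<subseteq> E'" using pA cE by (auto simp: part_def)
        then show False using ne uni[OF EE(1)] uni[OF EE(2)] card_subset_eq by metis
      qed
      moreover have "\<not> absent c H A" using EE ne pA by (auto simp: absent_def)
      ultimately have "A \<in> J" using ab[of A] by blast
      moreover have "B \<subseteq> A"
      proof
        fix b assume b: "b \<in> B"
        then have "b \<in> c ` E" using B cE(1) by auto
        then obtain x where "x \<in> E" "c x = b" by auto
        then have "x \<in> part c E B" using b by (simp add: part_def)
        then have "x \<in> E'" using eq by (auto simp: part_def)
        then show "b \<in> A" using \<open>x \<in> E\<close> \<open>c x = b\<close> by (auto simp: A_def)
      qed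
      ultimately show False using n by blast
    qed
    moreover have "(\<lambda>E. part c E B) ` H \<subseteq> nsets V (k - 2)"
    proof
      fix Y assume "Y \<in> (\<lambda>E. part c E B) ` H"
      then obtain E where "E \<in> H" "Y = part c E B" by blast
      then show "Y \<in> nsets V (k - 2)"
        using uni[of E] card_part[of c E k B] rb B by (auto simp: nsets_def part_def)
    qed
    ultimately have "card H \<le> card (nsets V (k - 2))"
      using V by (intro card_inj_on_le[of "\<lambda>E. part c E B"]) (auto simp: finite_imp_finite_nsets)
    then show False using large V by (simp add: card_nsets)
  qed
  have point: "\<exists>x\<in>E. c x = i \<and> part c E {i} = {x}" if "E \<in> H" "i < k" for E i
  proof -
    have cE: "c ` E = {..<k}" "inj_on c E" using rb that by (auto simp: bij_betw_def)
    have "i \<in> c ` E" using cE(1) that by simp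
    then obtain x where "x \<in> E" "c x = i" by blast
    then show ?thesis using cE(2) by (intro bexI[of _ x]) (auto simp: part_def inj_on_def)
  qed
  from intersection_closed_types[OF k J closed cover] show ?thesis
  proof
    assume "\<exists>u<k. \<exists>w<k. u \<noteq> w \<and> {u} \<in> J \<and> {w} \<in> J"
    then obtain u w where uw: "u < k" "w < k" "u \<noteq> w" "{u} \<in> J" "{w} \<in> J" by blast
    have "\<exists>u\<in>E. \<exists>w\<in>E. u \<noteq> w \<and> flexible s H {u} \<and> flexible s H {w}" if E: "E \<in> H" for E
    proof -
      obtain x where x: "x \<in> E" "c x = u" "part c E {u} = {x}" using point[OF E uw(1)] by blast
      obtain y where y: "y \<in> E" "c y = w" "part c E {w} = {y}" using point[OF E uw(2)] by blast
      have "x \<noteq> y" using x y uw by blast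
      moreover have "flexible s H {x}" "flexible s H {y}"
        using fx[OF uw(4) E] fx[OF uw(5) E] x y by simp_all
      ultimately show ?thesis using x(1) y(1) by blast
    qed
    then show ?thesis by blast
  next
    assume "\<exists>v<k. \<forall>d<k. d \<noteq> v \<longrightarrow> {v, d} \<in> J"
    then obtain v where v: "v < k" "\<And>d. d < k \<Longrightarrow> d \<noteq> v \<Longrightarrow> {v, d} \<in> J" by blast
    have "\<exists>v\<in>E. \<forall>d\<in>E - {v}. flexible s H {v, d}" if E: "E \<in> H" for E
    proof -
      obtain x where x: "x \<in> E" "c x = v" "part c E {v} = {x}" using point[OF E v(1)] by blast
      have inj: "inj_on c E" and img: "c ` E = {..<k}" using rb E by (auto simp: bij_betw_def)
      have "flexible s H {x, y}" if y: "y \<in> E - {x}" for y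
      proof -
        have "c y < k" using img y by blast
        moreover have "c y \<noteq> v" using inj x y by (auto simp: inj_on_def)
        ultimately have "flexible s H (part c E {v, c y})" using fx[OF v(2) E] by blast
        moreover have "part c E {v, c y} = {x, y}"
          using inj x y by (auto simp: part_def inj_on_def)
        ultimately show ?thesis by simp
      qed
      then show ?thesis using x(1) by blast
    qed
    then show ?thesis by blast
  qed
qed

text \<open>A colouring that is bijective on edges costs a factor \<open>k ^ k\<close>. The
  remaining edges without centre contain no large homogeneous subfamily, since the dichotomy would
  yield a path or an edge with a centre.\<close>

lemma few_edges_without_center:
  assumes k: "k \<ge> 4" and s: "2 * k \<le> s" "l * k \<le> s"
  shows "\<exists>M. \<forall>(V :: 'a set) F. finite V \<longrightarrow> F \<subseteq> nsets V k \<longrightarrow>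
    \<not> (\<exists>f. is_path k l f \<and> f ` {..<l} \<subseteq> F) \<longrightarrow>
    card {E \<in> F. \<not> (\<exists>v\<in>E. \<forall>d\<in>E - {v}. flexible s F {v, d})} \<le> M * (card V choose (k - 2))"
proof -
  define \<A> where "\<A> = Pow {..<k} - {{..<k}}"
  have "finite \<A>" "\<A> \<subseteq> Pow {..<k}" by (auto simp: \<A>_def)
  from homogeneous_bound[OF this, of s, where 'a = 'a] obtain M where
    M: "\<forall>(c :: 'a \<Rightarrow> nat) H h. finite H \<longrightarrow> (\<forall>E\<in>H. bij_betw c E {..<k}) \<longrightarrow>
    (\<forall>H' J. H' \<subseteq> H \<longrightarrow> homogeneous s \<A> c H' J \<longrightarrow> card H' \<le> h) \<longrightarrow> card H \<le> M * h" ..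
  have "card {E \<in> F. \<not> (\<exists>v\<in>E. \<forall>d\<in>E - {v}. flexible s F {v, d})} \<le> k ^ k * M * (card V choose (k - 2))"
    if V: "finite V" and FV: "F \<subseteq> nsets V k" and free: "\<not> (\<exists>f. is_path k l f \<and> f ` {..<l} \<subseteq> F)"
    for V :: "'a set" and F
  proof -
    define B where "B = {E \<in> F. \<not> (\<exists>v\<in>E. \<forall>d\<in>E - {v}. flexible s F {v, d})}"
    have BF: "B \<subseteq> F" by (auto simp: B_def)
    have finB: "finite B"
      using FV BF V finite_imp_finite_nsets finite_subset by (metis subset_trans)
    have uni: "finite E" "card E = k" "E \<subseteq> V" if "E \<in> F" for E using FV that by (auto simp: nsets_def)
    have "\<forall>E\<in>B. \<exists>g. bij_betw g E {..<k}"
      using ex_bij_betw_finite_nat uni BF by (metis atLeast0LessThan subsetD)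
    from bchoice[OF this] obtain g where g: "\<And>E. E \<in> B \<Longrightarrow> bij_betw (g E) E {..<k}" by blast
    have "\<exists>c. card B \<le> k ^ k * card {E \<in> B. \<forall>x\<in>E. c x = g E x}"
    proof (rule exists_agreeing_coloring[OF V finB])
      show "g E x < k" if "E \<in> B" "x \<in> E" for E x using bij_betwE[OF g[OF that(1)]] that by auto
    qed (use k uni BF in auto)
    then obtain c where c: "card B \<le> k ^ k * card {E \<in> B. \<forall>x\<in>E. c x = g E x}" ..
    define H where "H = {E \<in> B. \<forall>x\<in>E. c x = g E x}"
    have HB: "H \<subseteq> B" by (auto simp: H_def)
    have rb: "\<forall>E\<in>H. bij_betw c E {..<k}"
    proof
      fix E assume "E \<in> H"
      then show "bij_betw c E {..<k}"
        using g[of E] bij_betw_cong[of E c "g E" "{..<k}"] by (auto simp: H_def)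
    qed
    have small: "card H' \<le> card V choose (k - 2)" if H': "H' \<subseteq> H" "homogeneous s \<A> c H' J" for H' J
    proof (rule ccontr)
      assume "\<not> ?thesis"
      then have large: "card V choose (k - 2) < card H'" by simp
      have HF: "H' \<subseteq> F" using H' HB BF by blast
      have ne: "H' \<noteq> {}" using large by auto
      have HV: "H' \<subseteq> nsets V k" and rb': "\<forall>E\<in>H'. bij_betw c E {..<k}" using HF FV rb H' by auto
      from homogeneous_dichotomy[OF k s(1) V HV rb' H'(2)[unfolded \<A>_def] large] show False
      proof
        assume pts: "\<forall>E\<in>H'. \<exists>u\<in>E. \<exists>w\<in>E. u \<noteq> w \<and> flexible s H' {u} \<and> flexible s H' {w}"
        have "\<exists>f. is_path k l f \<and> f ` {..<l} \<subseteq> H'"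
          by (rule path_of_flexible_points[OF _ ne _ s(2)]) (use uni HF pts in auto)
        then show False using free HF by blast
      next
        assume ctr: "\<forall>E\<in>H'. \<exists>v\<in>E. \<forall>d\<in>E - {v}. flexible s H' {v, d}"
        obtain E where E: "E \<in> H'" using ne by blast
        then obtain v where v: "v \<in> E" "\<forall>d\<in>E - {v}. flexible s H' {v, d}" using ctr by blast
        \<comment> \<open>Flexibility in \<open>H'\<close> carries over to the larger family
          \<open>F\<close>, with respect to which the edges of \<open>B\<close> have no
          centre.\<close>
        have "\<forall>d\<in>E - {v}. flexible s F {v, d}" using v(2) by (auto intro: flexible_mono[OF _ HF])
        then have "\<exists>v\<in>E. \<forall>d\<in>E - {v}. flexible s F {v, d}" using v(1) by blast
        moreover have "E \<in> B" using E H' HB by blast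
        ultimately show False unfolding B_def by blast
      qed
    qed
    have "finite H" using HB finB finite_subset by blast
    then have "card H \<le> M * (card V choose (k - 2))"
      using rb small by (intro M[rule_format, of H c]) auto
    then have "k ^ k * card H \<le> k ^ k * (M * (card V choose (k - 2)))" by (rule mult_le_mono2)
    then show ?thesis
      using c unfolding B_def[symmetric] H_def[symmetric] mult.assoc by (rule le_trans[rotated])
  qed
  then show ?thesis by (intro exI[of _ "k ^ k * M"] allI impI)
qed

section \<open>Sets with many centres\<close>

text \<open>Deleting a point of degree at most \<open>d\<close>, together with the sets through it,
  preserves \<open>d * card V < card \<D>\<close>, so the deletion stops at a nonempty family. This
  may be \<open>{{}}\<close>, which has no points.\<close>

lemma min_degree_subfamily:
  assumes "finite V" "\<D> \<subseteq> Pow V" "d * card V < card \<D>"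
  shows "\<exists>\<E>\<subseteq>\<D>. \<E> \<noteq> {} \<and> (\<forall>y\<in>\<Union>\<E>. d < card {D \<in> \<E>. y \<in> D})"
  using assms
proof (induction V arbitrary: \<D> rule: finite_psubset_induct)
  case (psubset V)
  show ?case
  proof (cases "\<forall>y\<in>\<Union>\<D>. d < card {D \<in> \<D>. y \<in> D}")
    case True
    then show ?thesis using psubset.prems by (intro exI[of _ \<D>]) auto
  next
    case False
    then obtain y where y: "y \<in> \<Union>\<D>" "card {D \<in> \<D>. y \<in> D} \<le> d" by (auto simp: not_less)
    have yV: "y \<in> V" using y psubset.prems by auto
    have fin: "finite \<D>" using psubset finite_subset by (metis finite_Pow_iff)
    define \<D>' where "\<D>' = {D \<in> \<D>. y \<notin> D}"
    have "\<D> = \<D>' \<union> {D \<in> \<D>. y \<in> D}" by (auto simp: \<D>'_def)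
    then have "card \<D> \<le> card \<D>' + card {D \<in> \<D>. y \<in> D}" using card_Un_le by metis
    moreover have "card V = Suc (card (V - {y}))"
      using psubset.hyps yV by (metis card_Suc_Diff1)
    ultimately have "d * card (V - {y}) < card \<D>'" using y psubset.prems(2) by simp
    moreover have "V - {y} \<subset> V" "\<D>' \<subseteq> Pow (V - {y})" using yV psubset.prems(1) by (auto simp: \<D>'_def)
    ultimately obtain \<E> where "\<E> \<subseteq> \<D>'" "\<E> \<noteq> {}" "\<forall>y\<in>\<Union>\<E>. d < card {D \<in> \<E>. y \<in> D}"
      using psubset.IH[of "V - {y}" \<D>'] by (elim meta_impE exE conjE)
    then show ?thesis by (intro exI[of _ \<E>]) (auto simp: \<D>'_def)
  qed
qed

text \<open>The walk moves from \<open>y m\<close> to a fresh point of a common set \<open>D\<close>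
  and picks a fresh \<open>x m\<close> in \<open>W D\<close>, which has more than \<open>t\<close>
  elements while at most \<open>t\<close> are taken. That no \<open>y i\<close> equals an
  \<open>x j\<close> is ensured later by a colouring.\<close>

lemma zigzag_sequence:
  fixes \<E> :: "'a set set" and W :: "'a set \<Rightarrow> 'a set"
  assumes ne: "\<E> \<noteq> {}" "{} \<notin> \<E>"
    and deg: "\<And>y. y \<in> \<Union>\<E> \<Longrightarrow> 2 ^ (t + 2) < card {D \<in> \<E>. y \<in> D}"
    and W: "\<And>D. D \<in> \<E> \<Longrightarrow> t < card (W D)"
  shows "\<exists>y x. inj_on y {..Suc t} \<and> inj_on x {..t} \<and>
    (\<forall>i\<le>t. \<exists>D\<in>\<E>. y i \<in> D \<and> y (Suc i) \<in> D \<and> x i \<in> W D)"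
proof -
  have "\<exists>y x. inj_on y {..m} \<and> inj_on x {..<m} \<and> y m \<in> \<Union>\<E> \<and>
    (\<forall>i<m. \<exists>D\<in>\<E>. y i \<in> D \<and> y (Suc i) \<in> D \<and> x i \<in> W D)" if "m \<le> Suc t" for m
    using that
  proof (induction m)
    case 0
    obtain D v where "D \<in> \<E>" "v \<in> D" using ne by (metis all_not_in_conv)
    then have "v \<in> \<Union>\<E>" by blast
    then show ?case by (intro exI[of _ "\<lambda>_. v"]) auto
  next
    case (Suc m)
    then have "m \<le> Suc t" by simp
    from Suc.IH[OF this] obtain y x where y: "inj_on y {..m}" and x: "inj_on x {..<m}" and ym: "y m \<in> \<Union>\<E>"
      and D: "\<forall>i<m. \<exists>D\<in>\<E>. y i \<in> D \<and> y (Suc i) \<in> D \<and> x i \<in> W D"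
      by (elim exE conjE)
    \<comment> \<open>The at most \<open>t + 1\<close> visited points have fewer than
      \<open>2 ^ (t + 2)\<close> subsets, so some set through \<open>y m\<close> leaves
      them.\<close>
    have "\<exists>D\<in>\<E>. y m \<in> D \<and> \<not> D \<subseteq> y ` {..m}"
    proof (rule ccontr)
      assume "\<not> ?thesis"
      then have "{D \<in> \<E>. y m \<in> D} \<subseteq> Pow (y ` {..m})" by blast
      then have "card {D \<in> \<E>. y m \<in> D} \<le> 2 ^ card (y ` {..m})"
        using card_mono[of "Pow (y ` {..m})"] by (simp add: card_Pow)
      also have "\<dots> \<le> 2 ^ (t + 2)"
        using card_image_le[of "{..m}" y] Suc.prems by (intro power_increasing) auto
      finally show False using deg[OF ym] by simp
    qed
    then obtain D0 v where D0: "D0 \<in> \<E>" "y m \<in> D0" "v \<in> D0" "v \<notin> y ` {..m}" by blast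
    have "\<not> W D0 \<subseteq> x ` {..<m}"
    proof
      assume "W D0 \<subseteq> x ` {..<m}"
      then have "card (W D0) \<le> card (x ` {..<m})" by (intro card_mono) auto
      also have "\<dots> \<le> m" using card_image_le[of "{..<m}" x] by simp
      finally show False using W[OF D0(1)] Suc.prems by simp
    qed
    then obtain w where w: "w \<in> W D0" "w \<notin> x ` {..<m}" by blast
    have "inj_on (y(Suc m := v)) {..Suc m}"
      using y D0 by (auto simp: inj_on_def le_Suc_eq)
    moreover have "inj_on (x(m := w)) {..<Suc m}"
      using x w by (auto simp: inj_on_def less_Suc_eq)
    moreover have "\<forall>i<Suc m. \<exists>D\<in>\<E>. (y(Suc m := v)) i \<in> D \<and> (y(Suc m := v)) (Suc i) \<in> D \<and> (x(m := w)) i \<in> W D"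
    proof (intro allI impI)
      fix i assume "i < Suc m"
      then consider "i < m" | "i = m" by linarith
      then show "\<exists>D\<in>\<E>. (y(Suc m := v)) i \<in> D \<and> (y(Suc m := v)) (Suc i) \<in> D \<and> (x(m := w)) i \<in> W D"
      proof cases
        case 1
        then show ?thesis using D by auto
      next
        case 2
        then show ?thesis using D0 w by (intro bexI[of _ D0]) auto
      qed
    qed
    moreover have "(y(Suc m := v)) (Suc m) \<in> \<Union>\<E>" using D0 by auto
    ultimately show ?case by (intro exI[of _ "y(Suc m := v)"] exI[of _ "x(m := w)"] conjI)
  qed
  from this[OF order_refl] obtain y x where "inj_on y {..Suc t}" "inj_on x {..<Suc t}"
    "\<forall>i<Suc t. \<exists>D\<in>\<E>. y i \<in> D \<and> y (Suc i) \<in> D \<and> x i \<in> W D"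
    by (elim exE conjE)
  then show ?thesis
    by (intro exI[of _ y] exI[of _ x]) (simp add: lessThan_Suc_atMost less_Suc_eq_le)
qed

text \<open>The set \<open>insert v D\<close> may fail to be an edge: the zigzag path is built from
  the flexible pairs \<open>{v, d}\<close> alone.\<close>

definition centers :: "nat \<Rightarrow> 'a set \<Rightarrow> 'a set set \<Rightarrow> 'a set \<Rightarrow> 'a set" where
  "centers s V F D = {v \<in> V - D. \<forall>d\<in>D. flexible s F {v, d}}"

text \<open>A two-colouring separates points of the sets \<open>D\<close> (colour 0) from their
  chosen centres (colour 1). If many sets agreed with it, a subfamily of large minimum degree would
  carry a zigzag of \<open>2 * t + 2\<close> flexible pairs, and
  \<open>path_of_flexible_pairs\<close> would contradict \<open>free\<close>.\<close>

lemma few_sets_with_many_centers: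
  assumes k: "k \<ge> 2" and s: "(2 * t + 2) * k + Suc (2 * t + 2) \<le> s"
    and V: "finite V" and FV: "F \<subseteq> nsets V k"
    and free: "\<not> (\<exists>f. is_path k (2 * t + 2) f \<and> f ` {..<2 * t + 2} \<subseteq> F)"
  shows "card {D \<in> nsets V (k - 1). t < card (centers s V F D)} \<le> 2 ^ (k + t) * (2 ^ (t + 2) * card V)"
proof -
  define \<D> where "\<D> = {D \<in> nsets V (k - 1). t < card (centers s V F D)}"
  have finD: "finite \<D>" using V by (simp add: \<D>_def finite_imp_finite_nsets)
  \<comment> \<open>Keeping exactly \<open>t + 1\<close> centres bounds the size of
    \<open>D \<union> W D\<close> by \<open>(k - 1) + (t + 1) = k + t\<close>, the exponent in the
    loss from colouring.\<close>
  have "\<forall>D\<in>\<D>. \<exists>W. W \<subseteq> centers s V F D \<and> card W = Suc t"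
  proof
    fix D assume "D \<in> \<D>"
    then have "Suc t \<le> card (centers s V F D)" by (simp add: \<D>_def)
    then show "\<exists>W. W \<subseteq> centers s V F D \<and> card W = Suc t" by (meson obtain_subset_with_card_n)
  qed
  from bchoice[OF this] obtain W where W: "\<And>D. D \<in> \<D> \<Longrightarrow> W D \<subseteq> centers s V F D \<and> card (W D) = Suc t"
    by blast
  have DV: "D \<subseteq> V" "finite D" "card D = k - 1" if "D \<in> \<D>" for D using that by (auto simp: \<D>_def nsets_def)
  have WV: "W D \<subseteq> V" if "D \<in> \<D>" for D using W[OF that] by (auto simp: centers_def)
  define g :: "'a set \<Rightarrow> 'a \<Rightarrow> nat" where "g D x = (if x \<in> D then 0 else 1)" for D x
  have "\<exists>c. card \<D> \<le> 2 ^ (k + t) * card {D \<in> \<D>. \<forall>x\<in>D \<union> W D. c x = g D x}"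
  proof (rule exists_agreeing_coloring[OF V finD])
    show "card (D \<union> W D) \<le> k + t" if "D \<in> \<D>" for D
      using card_Un_le[of D "W D"] DV[OF that] W[OF that] k by simp
  qed (use DV WV in \<open>auto simp: g_def\<close>)
  then obtain c where c: "card \<D> \<le> 2 ^ (k + t) * card {D \<in> \<D>. \<forall>x\<in>D \<union> W D. c x = g D x}" ..
  define \<D>' where "\<D>' = {D \<in> \<D>. \<forall>x\<in>D \<union> W D. c x = g D x}"
  have "card \<D>' \<le> 2 ^ (t + 2) * card V"
  proof (rule ccontr)
    assume "\<not> ?thesis"
    then have large: "2 ^ (t + 2) * card V < card \<D>'" by simp
    have "\<D>' \<subseteq> Pow V" using DV by (auto simp: \<D>'_def)
    then obtain \<E> where E: "\<E> \<subseteq> \<D>'" "\<E> \<noteq> {}" "\<forall>y\<in>\<Union>\<E>. 2 ^ (t + 2) < card {D \<in> \<E>. y \<in> D}"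
      using min_degree_subfamily[OF V _ large] by (elim meta_impE exE conjE)
    have ED: "D \<in> \<D>" if "D \<in> \<E>" for D using that E(1) by (auto simp: \<D>'_def)
    have "{} \<notin> \<E>"
    proof
      assume "{} \<in> \<E>"
      then show False using DV(3)[OF ED] k by force
    qed
    then have "\<exists>y x. inj_on y {..Suc t} \<and> inj_on x {..t} \<and>
      (\<forall>i\<le>t. \<exists>D\<in>\<E>. y i \<in> D \<and> y (Suc i) \<in> D \<and> x i \<in> W D)"
      using E W ED by (intro zigzag_sequence) auto
    then obtain y x where y: "inj_on y {..Suc t}" and x: "inj_on x {..t}"
      and D: "\<forall>i\<le>t. \<exists>D\<in>\<E>. y i \<in> D \<and> y (Suc i) \<in> D \<and> x i \<in> W D"
      by (elim exE conjE)
    have cy: "c v = 0" if "D \<in> \<E>" "v \<in> D" for D v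
      using that E(1) by (auto simp: \<D>'_def g_def)
    have cx: "c v = 1" if "D \<in> \<E>" "v \<in> W D" for D v
    proof -
      have "v \<notin> D" using W[OF ED[OF that(1)]] that by (auto simp: centers_def)
      then show ?thesis using that E(1) by (auto simp: \<D>'_def g_def)
    qed
    have cyi: "c (y i) = 0" if "i \<le> Suc t" for i
    proof (cases "i \<le> t")
      case True
      then show ?thesis using D cy by blast
    next
      case False
      then have "i = Suc t" using that by simp
      moreover have "\<exists>D\<in>\<E>. y (Suc t) \<in> D" using D[rule_format, of t] by blast
      ultimately show ?thesis using cy by auto
    qed
    have cxi: "c (x i) = 1" if "i \<le> t" for i using D[rule_format, OF that] cx by auto
    \<comment> \<open>\<open>p\<close> runs through
      \<open>y 0, x 0, y 1, x 1, ..., x t, y (Suc t)\<close>, which are \<open>2 * t + 3\<close>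
      points. Their colours alternate, so equal values force indices of equal parity.\<close>
    define p where "p n = (if even n then y (n div 2) else x (n div 2))" for n
    have inj: "inj_on p {..2 * t + 2}"
    proof (rule inj_onI)
      fix m n assume mn: "m \<in> {..2 * t + 2}" "n \<in> {..2 * t + 2}" and eq: "p m = p n"
      have col: "c (p n) = (if even n then 0 else 1)" if "n \<in> {..2 * t + 2}" for n
      proof (cases "even n")
        case True
        then show ?thesis using cyi[of "n div 2"] that by (simp add: p_def)
      next
        case False
        then have "n div 2 \<le> t" using that by (auto elim!: oddE)
        then show ?thesis using cxi[of "n div 2"] False by (simp add: p_def)
      qed
      have par: "even m = even n" using col[OF mn(1)] col[OF mn(2)] unfolding eq by presburger
      have "m div 2 = n div 2"
      proof (cases "even n")
        case True
        then show ?thesis using eq par mn inj_onD[OF y, of "m div 2" "n div 2"] by (simp add: p_def)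
      next
        case False
        then have "n div 2 \<le> t" "m div 2 \<le> t" using mn par by (auto elim!: oddE)
        then show ?thesis using eq par False inj_onD[OF x, of "m div 2" "n div 2"] by (simp add: p_def)
      qed
      then show "m = n" using par by (metis even_two_times_div_two odd_two_times_div_two_succ)
    qed
    have flex: "flexible s F {p i, p (Suc i)}" if i: "i < 2 * t + 2" for i
    proof -
      have "i div 2 \<le> t" using i by simp
      then obtain D0 where D0: "D0 \<in> \<E>" "y (i div 2) \<in> D0" "y (Suc (i div 2)) \<in> D0" "x (i div 2) \<in> W D0"
        using D[rule_format, OF \<open>i div 2 \<le> t\<close>] by (elim bexE conjE)
      have "flexible s F {x (i div 2), d}" if "d \<in> D0" for d
        using W[OF ED[OF D0(1)]] D0(4) that by (auto simp: centers_def)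
      then have "flexible s F {x (i div 2), y (i div 2)}" "flexible s F {x (i div 2), y (Suc (i div 2))}"
        using D0 by blast+
      then show ?thesis by (cases "even i") (auto simp: p_def insert_commute elim!: evenE oddE)
    qed
    have "\<exists>f. is_path k (2 * t + 2) f \<and> f ` {..<2 * t + 2} \<subseteq> F"
      by (rule path_of_flexible_pairs[OF _ inj flex s]) (use FV in \<open>auto simp: nsets_def\<close>)
    then show False using free by blast
  qed
  then have "2 ^ (k + t) * card \<D>' \<le> 2 ^ (k + t) * (2 ^ (t + 2) * card V)" by (rule mult_le_mono2)
  then show ?thesis using c unfolding \<D>'_def \<D>_def by (rule le_trans[rotated])
qed

section \<open>The bound\<close>

text \<open>An edge with centre \<open>v\<close> is \<open>insert v D\<close> with \<open>v\<close>
  among the centres of \<open>D\<close>. Each \<open>D\<close> accounts for at most \<open>t\<close>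
  such edges, apart from at most \<open>K * card V\<close> exceptional sets with at most
  \<open>card V\<close> edges each; these give the quadratic term.\<close>

lemma path_free_card_le:
  assumes k: "k \<ge> 4"
  shows "\<exists>M K. \<forall>(V :: 'a set) F. finite V \<longrightarrow> F \<subseteq> nsets V k \<longrightarrow>
    \<not> (\<exists>f. is_path k (2 * t + 2) f \<and> f ` {..<2 * t + 2} \<subseteq> F) \<longrightarrow>
    card F \<le> M * (card V choose (k - 2)) + (t * (card V choose (k - 1)) + K * card V ^ 2)"
proof -
  \<comment> \<open>Room for \<open>2 * t + 2\<close> edges and \<open>2 * t + 3\<close> skeleton
    points, as the path through flexible pairs demands; the other requirements are weaker.\<close>
  define s where "s = (2 * t + 2) * k + Suc (2 * t + 2)"
  define K where "K = (2::nat) ^ (k + t) * 2 ^ (t + 2)"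
  have s: "2 * k \<le> s" "(2 * t + 2) * k \<le> s" "(2 * t + 2) * k + Suc (2 * t + 2) \<le> s"
    by (simp_all add: s_def algebra_simps)
  from few_edges_without_center[OF k s(1,2), where 'a = 'a] obtain M where
    M: "\<forall>(V :: 'a set) F. finite V \<longrightarrow> F \<subseteq> nsets V k \<longrightarrow>
    \<not> (\<exists>f. is_path k (2 * t + 2) f \<and> f ` {..<2 * t + 2} \<subseteq> F) \<longrightarrow>
    card {E \<in> F. \<not> (\<exists>v\<in>E. \<forall>d\<in>E - {v}. flexible s F {v, d})} \<le> M * (card V choose (k - 2))" ..
  have "card F \<le> M * (card V choose (k - 2)) + (t * (card V choose (k - 1)) + K * card V ^ 2)"
    if V: "finite V" and FV: "F \<subseteq> nsets V k"
      and free: "\<not> (\<exists>f. is_path k (2 * t + 2) f \<and> f ` {..<2 * t + 2} \<subseteq> F)"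
    for V :: "'a set" and F
  proof -
    define B where "B = {E \<in> F. \<not> (\<exists>v\<in>E. \<forall>d\<in>E - {v}. flexible s F {v, d})}"
    define N where "N = centers s V F"
    define \<D> where "\<D> = {D \<in> nsets V (k - 1). t < card (N D)}"
    have finNs: "finite (nsets V (k - 1))" using V by (simp add: finite_imp_finite_nsets)
    have finN: "finite (N D)" "card (N D) \<le> card V" for D
    proof -
      have "N D \<subseteq> V" by (auto simp: N_def centers_def)
      then show "finite (N D)" "card (N D) \<le> card V" using V finite_subset card_mono by auto
    qed
    have cB: "card B \<le> M * (card V choose (k - 2))"
      unfolding B_def by (rule M[rule_format, OF V FV free])
    have cD: "card \<D> \<le> K * card V"
      using few_sets_with_many_centers[OF _ s(3) V FV free] k unfolding \<D>_def N_def K_def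
      by (simp add: mult.assoc)
    have cover: "F - B \<subseteq> (\<Union>D\<in>nsets V (k - 1). (\<lambda>v. insert v D) ` N D)"
    proof
      fix E assume E: "E \<in> F - B"
      then obtain v where v: "v \<in> E" "\<forall>d\<in>E - {v}. flexible s F {v, d}" by (auto simp: B_def)
      have EV: "E \<subseteq> V" "finite E" "card E = k" using E FV by (auto simp: nsets_def)
      have "E - {v} \<in> nsets V (k - 1)" using EV v(1) by (auto simp: nsets_def)
      moreover have "v \<in> N (E - {v})" using v EV by (auto simp: N_def centers_def)
      moreover have "E = insert v (E - {v})" using v(1) by blast
      ultimately show "E \<in> (\<Union>D\<in>nsets V (k - 1). (\<lambda>v. insert v D) ` N D)" by blast
    qed
    have "card (F - B) \<le> card (\<Union>D\<in>nsets V (k - 1). (\<lambda>v. insert v D) ` N D)"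
      using finNs finN by (intro card_mono[OF _ cover]) auto
    also have "\<dots> \<le> (\<Sum>D\<in>nsets V (k - 1). card ((\<lambda>v. insert v D) ` N D))"
      by (rule card_UN_le[OF finNs])
    also have "\<dots> \<le> (\<Sum>D\<in>nsets V (k - 1). t + (if D \<in> \<D> then card V else 0))"
    proof (rule sum_mono)
      fix D assume D: "D \<in> nsets V (k - 1)"
      have "card ((\<lambda>v. insert v D) ` N D) \<le> card (N D)" by (rule card_image_le[OF finN(1)])
      also have "\<dots> \<le> t + (if D \<in> \<D> then card V else 0)"
        using finN(2)[of D] D by (auto simp: \<D>_def)
      finally show "card ((\<lambda>v. insert v D) ` N D) \<le> t + (if D \<in> \<D> then card V else 0)" .
    qed
    also have "\<dots> = t * (card V choose (k - 1)) + card V * card \<D>"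
    proof -
      have "\<D> = {D \<in> nsets V (k - 1). D \<in> \<D>}" by (auto simp: \<D>_def)
      then have "(\<Sum>D\<in>nsets V (k - 1). if D \<in> \<D> then card V else 0) = card V * card \<D>"
        using sum.inter_filter[OF finNs, of "\<lambda>_. card V" "\<lambda>D. D \<in> \<D>"]
        by (simp add: mult.commute)
      then show ?thesis by (simp add: sum.distrib card_nsets)
    qed
    also have "\<dots> \<le> t * (card V choose (k - 1)) + K * card V ^ 2"
      using mult_le_mono2[OF cD, of "card V"] by (simp add: power2_eq_square mult.left_commute)
    finally have "card (F - B) \<le> t * (card V choose (k - 1)) + K * card V ^ 2" .
    moreover have "card F \<le> card B + card (F - B)"
      using card_Un_le[of B "F - B"] by (simp add: B_def Un_absorb1)
    ultimately show ?thesis using cB by linarith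
  qed
  then show ?thesis by (intro exI[of _ M] exI[of _ K] allI impI)
qed

lemma binomial_le_power: "m choose r \<le> m ^ r"
  by (cases "r \<le> m") (simp_all add: binomial_le_pow binomial_eq_0)

theorem theorem4p5:
  fixes k t :: nat
  assumes "k \<ge> 4" and "t \<ge> 1"
  shows "\<exists>C::real. \<forall>n\<ge>1. \<forall>(P :: nat set set) (Q :: nat set set).
           linear_path k (2 * t + 1) P \<longrightarrow> linear_path k (2 * t + 2) Q \<longrightarrow>
             ex_turan k n P \<le> ex_turan k n Q \<and>
             real (ex_turan k n Q) \<le> real t * real ((n - 1) choose (k - 1)) + C * real n ^ (k - 2)"
proof -
  obtain M K where MK: "\<forall>(V :: nat set) F. finite V \<longrightarrow> F \<subseteq> nsets V k \<longrightarrow>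
    \<not> (\<exists>f. is_path k (2 * t + 2) f \<and> f ` {..<2 * t + 2} \<subseteq> F) \<longrightarrow>
    card F \<le> M * (card V choose (k - 2)) + (t * (card V choose (k - 1)) + K * card V ^ 2)"
    using path_free_card_le[OF assms(1), of t, where 'a = nat] by (elim exE)
  have mono: "ex_turan k n P \<le> ex_turan k n Q"
    if "linear_path k (2 * t + 1) P" "linear_path k (2 * t + 2) Q" for n and P Q :: "nat set set"
    using that assms by (intro ex_turan_linear_path_mono[of "2 * t + 1" "2 * t + 2" k]) auto
  have nat_bound: "ex_turan k n Q \<le> t * ((n - 1) choose (k - 1)) + (M + t + K) * n ^ (k - 2)"
    if n: "n \<ge> 1" and Q: "linear_path k (2 * t + 2) Q" for n and Q :: "nat set set"
  proof -
    have "ex_turan k n Q \<le> M * (n choose (k - 2)) + (t * (n choose (k - 1)) + K * n ^ 2)"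
    proof (rule ex_turan_linear_path_le[OF _ Q])
      fix F :: "nat set set"
      assume "F \<subseteq> nsets {1..n} k" "\<not> (\<exists>f. is_path k (2 * t + 2) f \<and> f ` {..<2 * t + 2} \<subseteq> F)"
      then show "card F \<le> M * (n choose (k - 2)) + (t * (n choose (k - 1)) + K * n ^ 2)"
        using MK[rule_format, of "{1..n}" F] by simp
    qed (use assms in auto)
    moreover have "M * (n choose (k - 2)) \<le> M * n ^ (k - 2)"
      by (rule mult_le_mono2[OF binomial_le_power])
    \<comment> \<open>Here \<open>k \<ge> 4\<close> makes the quadratic term part of the error
      term.\<close>
    moreover have "K * n ^ 2 \<le> K * n ^ (k - 2)"
      using n assms by (intro mult_le_mono2 power_increasing) auto
    \<comment> \<open>By Pascal's rule, replacing \<open>n\<close> by \<open>n - 1\<close> in the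
      main term costs \<open>t * ((n - 1) choose (k - 2))\<close>, which the error term
      absorbs.\<close>
    moreover have "t * (n choose (k - 1)) \<le> t * ((n - 1) choose (k - 1)) + t * n ^ (k - 2)"
    proof -
      have "n choose (k - 1) = ((n - 1) choose (k - 2)) + ((n - 1) choose (k - 1))"
      proof -
        have "n = Suc (n - 1)" "k - 1 = Suc (k - 2)" using n assms by auto
        then show ?thesis by (metis binomial_Suc_Suc)
      qed
      moreover have "(n - 1) choose (k - 2) \<le> n ^ (k - 2)"
        using binomial_le_power[of "n - 1" "k - 2"] power_mono[of "n - 1" n "k - 2"] by linarith
      ultimately have "n choose (k - 1) \<le> ((n - 1) choose (k - 1)) + n ^ (k - 2)" by linarith
      then show ?thesis unfolding distrib_left[symmetric] by (rule mult_le_mono2)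
    qed
    ultimately show ?thesis unfolding distrib_right by linarith
  qed
  have "real (ex_turan k n Q) \<le> real t * real ((n - 1) choose (k - 1)) + real (M + t + K) * real n ^ (k - 2)"
    if "n \<ge> 1" "linear_path k (2 * t + 2) Q" for n and Q :: "nat set set"
    using nat_bound[OF that] unfolding of_nat_mult[symmetric] of_nat_power[symmetric] of_nat_add[symmetric]
    by (simp only: of_nat_le_iff)
  then show ?thesis using mono by (intro exI[of _ "real (M + t + K)"] allI impI conjI)
qed

end
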